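(* Let $d\ge 1$, let $B(t)=(B_1(t),\ldots,B_d(t))^\prime$, $0\le t\le 1$, be defined on a probability space, where $B_1,\ldots,B_d$ are i.i.d. copies of standard Brownian motion on $[0,1]$. Let $w:[0,1]\to[0,\infty)$ be continuous on $[0,1]$ and strictly positive on an interval $(0,c)$ for some $c\in(0,1]$, and let $f(t)=w(t)B(t)$, $0\le t\le 1$. Define $$K_d=\Big\{y\in\mathbb{R}^d:\min_{0\le t\le 1}(1+y^\prime f(t))>0\Big\},\qquad \overline{K}_d=\Big\{y\in\mathbb{R}^d:\min_{0\le t\le 1}(1+y^\prime f(t))\ge 0\Big\},$$ $$g_d(a)=-\int_0^1\log(1+a^\prime f(t))\,dt,\qquad a\in\overline{K}_d .$$ Then, with probability 1, there exists an $\mathbb{R}^d$-valued random vector $Y_d$ satisfying the following. (i) $Y_d$ is the unique minimizer of $g_d(a)$ over $a\in\overline{K}_d$. Here $\overline{K}_d$ is the closure of $K_d$, and $K_d$ is open, bounded and convex in $\mathbb{R}^d$ (with probability 1). On $K_d$, $g_d$ is also real-valued, strictly convex and infinitely differentiable (with probability 1). (ii) $-\infty<g_d(Y_d)<0$, $\quad Y_d^\prime\int_0^1 f(t)\,dt>0$, $\quad 0\le\int_0^1\frac{Y_d^\prime f(t)}{1+Y_d^\prime f(t)}\,dt<\infty$. (iii) If $Y_d\in K_d$, then $Y_d$ is the unique solution $a\in K_d$ of $\int_0^1\frac{f(t)}{1+a^\prime f(t)}\,dt=0_d$; and if $\int_0^1\frac{f(t)}{1+a^\prime f(t)}\,dt=0_d$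 has a solution $a\in K_d$, then this solution is uniquely $Y_d$.
   Context: $0_d=(0,\ldots,0)^\prime\in\mathbb{R}^d$; $^\prime$ denotes transpose. The function $g_d$ is well defined on $\overline{K}_d$ with values in $(-\infty,+\infty]$ (convention $\log 0=-\infty$); the value $+\infty$ may be taken at some points of the boundary $\overline{K}_d\setminus K_d$. *)

theory Defs
  imports "HOL-Probability.Probability"
begin

text \<open>The initial value and path continuity are only required almost surely, so processes whose
  paths are all continuous and start at 0 are covered as well.  A monotone sequence of times in
  \<open>[0,1]\<close> may be eventually constant, so its initial segments are exactly the finite partitions.\<close>

definition std_brownian_motion :: "'w measure \<Rightarrow> (real \<Rightarrow> 'w \<Rightarrow> real) \<Rightarrow> bool" where
  "std_brownian_motion M W \<longleftrightarrow>
     (\<forall>t\<in>{0..1}. W t \<in> borel_measurable M) \<and>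
     (AE \<omega> in M. W 0 \<omega> = 0) \<and>
     (\<forall>n. \<forall>t::nat \<Rightarrow> real. mono t \<and> range t \<subseteq> {0..1} \<longrightarrow>
        prob_space.indep_vars M (\<lambda>_. borel) (\<lambda>k \<omega>. W (t (Suc k)) \<omega> - W (t k) \<omega>) {..<n}) \<and>
     (\<forall>s t. 0 \<le> s \<and> s < t \<and> t \<le> 1 \<longrightarrow>
        distributed M lborel (\<lambda>\<omega>. W t \<omega> - W s \<omega>) (normal_density 0 (sqrt (t - s)))) \<and>
     (AE \<omega> in M. continuous_on {0..1} (\<lambda>t. W t \<omega>))"

text \<open>Independence of the components is independence of whole processes, that is, of random
  elements of the product space \<open>\<real>\<^bsup>[0,1]\<^esup>\<close>.\<close>

definition std_brownian_motion_vec ::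
    "'w measure \<Rightarrow> (real \<Rightarrow> 'w \<Rightarrow> real ^ 'd) \<Rightarrow> bool" where
  "std_brownian_motion_vec M B \<longleftrightarrow>
     (\<forall>i. std_brownian_motion M (\<lambda>t \<omega>. B t \<omega> $ i)) \<and>
     prob_space.indep_vars M (\<lambda>_. \<Pi>\<^sub>M t\<in>{0..1::real}. (borel :: real measure))
       (\<lambda>i \<omega>. \<lambda>t\<in>{0..1}. B t \<omega> $ i) UNIV"

abbreviation unit_lborel :: "real measure" where
  "unit_lborel \<equiv> restrict_space lborel {0..1}"

text \<open>The logarithm of interest is that of numbers \<open>\<ge> 0\<close>, with \<open>log 0 = -\<infinity>\<close>; at negative
  arguments the value is a convention.\<close>

definition elog :: "real \<Rightarrow> ereal" where
  "elog x = (if x \<le> 0 then -\<infinity> else ereal (ln x))"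

text \<open>\<open>e2ennreal\<close> sends negative numbers to 0, so the two terms are the integrals of the positive
  and the negative part.  The integral is undefined if both are infinite; in that case this
  definition returns \<open>\<infinity> - \<infinity> = \<infinity>\<close>.\<close>

definition ereal_integral :: "'x measure \<Rightarrow> ('x \<Rightarrow> ereal) \<Rightarrow> ereal" where
  "ereal_integral M h =
     enn2ereal (\<integral>\<^sup>+x. e2ennreal (h x) \<partial>M) - enn2ereal (\<integral>\<^sup>+x. e2ennreal (- h x) \<partial>M)"

definition strictly_convex_on :: "'v::real_vector set \<Rightarrow> ('v \<Rightarrow> real) \<Rightarrow> bool" where
  "strictly_convex_on S h \<longleftrightarrow> convex S \<and>
     (\<forall>u. \<forall>x\<in>S. \<forall>y\<in>S. 0 < u \<and> u < 1 \<and> x \<noteq> y \<longrightarrow>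
        h ((1 - u) *\<^sub>R x + u *\<^sub>R y) < (1 - u) * h x + u * h y)"

text \<open>For open \<open>S\<close> these are the \<open>k\<close> times continuously differentiable functions.\<close>

primrec times_differentiable_on :: "nat \<Rightarrow> ('v::euclidean_space \<Rightarrow> real) \<Rightarrow> 'v set \<Rightarrow> bool" where
  "times_differentiable_on 0 h S \<longleftrightarrow> continuous_on S h"
| "times_differentiable_on (Suc k) h S \<longleftrightarrow>
     (\<forall>x\<in>S. h differentiable (at x)) \<and>
     (\<forall>v. times_differentiable_on k (\<lambda>x. frechet_derivative h (at x) v) S)"

definition infinitely_differentiable_on :: "('v::euclidean_space \<Rightarrow> real) \<Rightarrow> 'v set \<Rightarrow> bool" where
  "infinitely_differentiable_on h S \<longleftrightarrow> (\<forall>k. times_differentiable_on k h S)"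

text \<open>For a continuous path \<open>f\<close> the infimum over the compact interval is a minimum.\<close>

definition K_set :: "(real \<Rightarrow> 'v::real_inner) \<Rightarrow> 'v set" where
  "K_set f = {y. (INF t\<in>{0..1}. 1 + y \<bullet> f t) > 0}"

definition Kbar_set :: "(real \<Rightarrow> 'v::real_inner) \<Rightarrow> 'v set" where
  "Kbar_set f = {y. (INF t\<in>{0..1}. 1 + y \<bullet> f t) \<ge> 0}"

definition g_fun :: "(real \<Rightarrow> 'v::real_inner) \<Rightarrow> 'v \<Rightarrow> ereal" where
  "g_fun f a = - ereal_integral unit_lborel (\<lambda>t. elog (1 + a \<bullet> f t))"

definition stationary :: "(real \<Rightarrow> 'v::euclidean_space) \<Rightarrow> 'v \<Rightarrow> bool" where
  "stationary f a \<longleftrightarrow>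
     a \<in> K_set f \<and> (\<integral>t. f t /\<^sub>R (1 + a \<bullet> f t) \<partial>unit_lborel) = 0"

text \<open>For a continuous path the integral of the positive part of the logarithm is finite, so
  \<open>g_fun\<close> is well defined and never takes the value \<open>-\<infinity>\<close>.\<close>

lemma elog_positive_part_finite:
  fixes f :: "real \<Rightarrow> 'v::real_inner"
  assumes "continuous_on {0..1} f"
  shows "(\<integral>\<^sup>+t. e2ennreal (elog (1 + a \<bullet> f t)) \<partial>unit_lborel) < \<infinity>"
proof -
  have "compact ((\<lambda>t. a \<bullet> f t) ` {0..1})"
    by (intro compact_continuous_image continuous_intros assms) auto
  then obtain C where C: "\<And>t. t \<in> {0..1} \<Longrightarrow> \<bar>a \<bullet> f t\<bar> \<le> C"
    by (fastforce dest: compact_imp_bounded simp: bounded_iff)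
  have le: "e2ennreal (elog (1 + a \<bullet> f t)) \<le> ennreal C" if "t \<in> {0..1}" for t
  proof (cases "1 + a \<bullet> f t \<le> 0")
    case False
    then have "ln (1 + a \<bullet> f t) \<le> C"
      using ln_le_minus_one[of "1 + a \<bullet> f t"] C[OF that] by auto
    then show ?thesis using False by (simp add: elog_def ennreal_leI)
  qed (simp add: elog_def e2ennreal_neg)
  have "(\<integral>\<^sup>+t. e2ennreal (elog (1 + a \<bullet> f t)) \<partial>unit_lborel) \<le> (\<integral>\<^sup>+t. ennreal C \<partial>unit_lborel)"
    using le by (intro nn_integral_mono) (simp add: space_restrict_space)
  also have "\<dots> < \<infinity>"
    by (simp add: space_restrict_space emeasure_restrict_space)
  finally show ?thesis .
qed

lemma g_fun_neq_MInfty: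
  assumes "continuous_on {0..1} f"
  shows "g_fun f a \<noteq> -\<infinity>"
proof -
  define p where "p = enn2ereal (\<integral>\<^sup>+t. e2ennreal (elog (1 + a \<bullet> f t)) \<partial>unit_lborel)"
  define q where "q = enn2ereal (\<integral>\<^sup>+t. e2ennreal (- elog (1 + a \<bullet> f t)) \<partial>unit_lborel)"
  have "p \<noteq> \<infinity>"
    using elog_positive_part_finite[OF assms, of a]
    by (metis p_def enn2ereal_eq_top_iff infinity_ennreal_def less_irrefl)
  moreover have "0 \<le> q" by (simp add: q_def)
  ultimately have "p - q \<noteq> \<infinity>" by (cases p; cases q) auto
  then show ?thesis by (simp add: g_fun_def ereal_integral_def p_def q_def)
qed

end

theory Submission
  imports Defs
begin

text \<open>Everything in the theorem except the measurability of $Y$ is a statement about a single path: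
  it holds for a continuous path \<open>f\<close> with nonzero mean that enters every open half space
  $\{x : y'x < 0\}$. The half space property makes $K$ bounded and $g$ strictly convex, Fatou's lemma
  makes $g$ lower semicontinuous, and a nonzero mean prevents $0$ from being a critical point. The last
  inequality of (ii) is the limit as $s \to 0$ of the optimality inequality comparing $Y$ and
  $(1-s)Y$.

  A Brownian path visits every open orthant before time $c$: along rapidly decreasing times the
  increments are independent and lie in the orthant with constant probability, and each dominates the
  remaining value of the path. The integral of $w B_i$ is nonzero almost surely because its Riemann sums
  are centred Gaussian with variance bounded away from zero. Finally, $Y$ is the pointwise limit of the
  best among the first $n$ points of a countable dense set, hence measurable.\<close>

section \<open>Analysis on the unit interval\<close>

text \<open>The obstacle is the boundary of \<open>Kbar_set f\<close>: the minimizer may lie there,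
  with \<open>1 + Y \<bullet> f t\<close> vanishing at some times, so no derivative is available at
  it. Derivatives are therefore used only in the open set \<open>K_set f\<close>. Elsewhere they are
  replaced by the tangent inequality \<open>ln x - ln y \<le> (x - y) / y\<close>, in which only the
  base point has to come from \<open>K_set f\<close>, and by the fact that shrinking a point of
  \<open>Kbar_set f\<close> towards \<open>0\<close> lands in \<open>K_set f\<close>. For the same
  reason strict concavity of the integrated logarithm is proved for all points of finite value, not
  only inside \<open>K_set f\<close>. On the probabilistic side, measurability is given for each
  fixed time only. Integrals over time therefore enter as limits of Riemann sums, which are
  measurable in \<open>\<omega>\<close> and, after summation by parts, Gaussian. The times used for
  the orthants shrink so fast that Chebyshev's inequality and the Borel-Cantelli lemma suffice to
  control the remaining values of the path.\<close>

lemma prob_space_unit_lborel: "prob_space unit_lborel"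
  by (intro prob_space_restrict_space) auto

interpretation unit: prob_space unit_lborel
  by (rule prob_space_unit_lborel)

lemma space_unit_lborel [simp]: "space unit_lborel = {0..1}"
  by (simp add: space_restrict_space)

lemma continuous_on_imp_measurable_unit:
  fixes h :: "real \<Rightarrow> 'b::topological_space"
  assumes "continuous_on {0..1} h"
  shows "h \<in> borel_measurable unit_lborel"
  using borel_measurable_continuous_on_restrict[OF assms]
  by (simp add: measurable_def sets_restrict_space space_restrict_space)

lemma continuous_on_imp_integrable_unit:
  fixes h :: "real \<Rightarrow> 'b::euclidean_space"
  assumes "continuous_on {0..1} h"
  shows "integrable unit_lborel h"
  using borel_integrable_atLeastAtMost'[OF assms]
  by (simp add: set_integrable_def integrable_restrict_space)

lemma integral_unit_lborel:
  fixes h :: "real \<Rightarrow> 'b::euclidean_space"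
  assumes "continuous_on {0..1} h"
  shows "integral\<^sup>L unit_lborel h = integral {0..1} h"
  using set_borel_integral_eq_integral(2)[OF borel_integrable_atLeastAtMost'[OF assms]]
  by (simp add: set_lebesgue_integral_def integral_restrict_space)

text \<open>Equality in an integral inequality gives information for almost every time, whereas the
  half space property of a path concerns single times; continuity bridges the two.\<close>

lemma continuous_AE_unit_eq_0:
  fixes h :: "real \<Rightarrow> real"
  assumes "continuous_on {0..1} h" "AE t in unit_lborel. h t = 0" "t \<in> {0..1}"
  shows "h t = 0"
proof -
  have c: "continuous_on {0..1} (\<lambda>t. \<bar>h t\<bar>)"
    by (intro continuous_intros assms)
  have "integral\<^sup>L unit_lborel (\<lambda>t. \<bar>h t\<bar>) = 0"
    using assms(2) by (intro integral_eq_zero_AE) auto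
  then have "((\<lambda>t. \<bar>h t\<bar>) has_integral 0) (cbox 0 1)"
    using integral_unit_lborel[OF c] integrable_continuous_real[OF c]
    by (simp add: has_integral_integral)
  then have "\<bar>h t\<bar> = 0"
    using c assms(3) by (intro has_integral_0_cbox_imp_0[of 0 1 "\<lambda>t. \<bar>h t\<bar>"]) auto
  then show ?thesis by simp
qed

text \<open>The mean value theorem for the antiderivative \<open>F\<close> writes the integral over
  a cell as \<open>h z / n\<close> with \<open>z\<close> in that cell, so the error is at most the
  oscillation of \<open>h\<close> over cells of width \<open>1 / n\<close>.\<close>

lemma Riemann_sum_LIMSEQ:
  fixes h :: "real \<Rightarrow> real"
  assumes "continuous_on {0..1} h"
  shows "(\<lambda>n. (\<Sum>k<n. h (real k / real n)) / real n) \<longlonglongrightarrow> integral {0..1} h"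
proof (rule LIMSEQ_I)
  fix e :: real assume e: "0 < e"
  have "uniformly_continuous_on {0..1} h"
    by (intro compact_uniformly_continuous assms) auto
  then obtain d where d: "0 < d"
    "\<And>x y. x \<in> {0..1} \<Longrightarrow> y \<in> {0..1} \<Longrightarrow> \<bar>y - x\<bar> < d \<Longrightarrow> \<bar>h y - h x\<bar> < e / 2"
    using e unfolding uniformly_continuous_on_def dist_real_def
    by (metis half_gt_zero_iff)
  define F where "F = (\<lambda>x. integral {0..x} h)"
  have F: "(F has_real_derivative h x) (at x within {0..1})" if "x \<in> {0..1}" for x
    unfolding F_def by (rule integral_has_real_derivative[OF assms that])
  obtain N :: nat where N: "1 / d < real N" using reals_Archimedean2 by blast
  show "\<exists>no. \<forall>n\<ge>no. norm ((\<Sum>k<n. h (real k / real n)) / real n - integral {0..1} h) < e"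
  proof (intro exI allI impI)
    fix n assume n: "N \<le> n"
    with N d(1) have n0: "0 < n" by (cases n) (auto intro: Nat.gr0I simp: field_simps)
    have nd: "1 / real n < d"
      using N n n0 d(1) by (simp add: field_simps) (smt (verit) of_nat_mono mult_left_mono)
    have step: "\<bar>h (real k / n) / n - (F (real (Suc k) / n) - F (real k / n))\<bar> \<le> e / 2 / n"
      if k: "k < n" for k
    proof -
      have lt: "real k / n < real (Suc k) / n" using n0 by (simp add: divide_strict_right_mono)
      have le1: "real (Suc k) / n \<le> 1" using k n0 by (simp add: field_simps)
      have ge0: "0 \<le> real k / n" by simp
      have sub: "{real k / n .. real (Suc k) / n} \<subseteq> {0..1}"
        using order_trans[OF ge0] order_trans[OF _ le1] by (intro subsetI) simp
      have "\<exists>z\<in>{real k / n<..<real (Suc k) / n}.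
            F (real (Suc k) / n) - F (real k / n) = h z * (real (Suc k) / n - real k / n)"
        using lt sub
        by (intro mvt_simple)
           (auto simp flip: has_field_derivative_def intro!: DERIV_subset[OF F] dest: order_trans[OF ge0])
      then obtain z where z: "real k / n < z" "z < real (Suc k) / n"
        "F (real (Suc k) / n) - F (real k / n) = (real (Suc k) / n - real k / n) * h z" by (auto simp: mult.commute)
      have diff: "real (Suc k) / n - real k / n = 1 / n" using n0 by (simp add: field_simps)
      have "\<bar>h (real k / n) - h z\<bar> < e / 2"
        using z nd diff sub lt order_trans[OF ge0, of z] by (intro d(2)) auto
      then have "\<bar>h (real k / n) - h z\<bar> / n \<le> e / 2 / n"
        by (intro divide_right_mono) auto
      then show ?thesis unfolding z(3) diff by (simp add: diff_divide_distrib[symmetric])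
    qed
    have "(\<Sum>k<n. F (real (Suc k) / n) - F (real k / n)) = integral {0..1} h"
      using n0 sum_lessThan_telescope[of "\<lambda>k. F (real k / n)" n] by (simp add: F_def)
    then have "(\<Sum>k<n. h (real k / real n)) / real n - integral {0..1} h =
        (\<Sum>k<n. h (real k / n) / n - (F (real (Suc k) / n) - F (real k / n)))"
      by (simp only: sum_subtractf sum_divide_distrib)
    also have "\<bar>\<dots>\<bar> \<le> (\<Sum>k<n. e / 2 / n)"
      using step by (intro order_trans[OF sum_abs] sum_mono) auto
    also have "\<dots> < e" using n0 e by simp
    finally show "norm ((\<Sum>k<n. h (real k / real n)) / real n - integral {0..1} h) < e" by simp
  qed
qed

text \<open>With values in \<open>ereal\<close> the logarithm is continuous even at
  \<open>0\<close>. Limits and measurability of \<open>elog (1 + a \<bullet> f t)\<close> thus need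
  no case distinction at times where the argument vanishes.\<close>

lemma isCont_elog: "isCont elog x"
proof -
  consider "x < 0" | "x = 0" | "0 < x" by linarith
  then show ?thesis
  proof cases
    case 1
    have "isCont (\<lambda>y. -\<infinity>) x" by simp
    moreover have "\<forall>\<^sub>F y in nhds x. elog y = -\<infinity>"
      using 1 by (auto simp: elog_def intro!: eventually_nhds_in_open[THEN eventually_mono, of "{..<0}"])
    ultimately show ?thesis by (simp add: isCont_cong)
  next
    case 2
    have "(elog \<longlongrightarrow> -\<infinity>) (at 0)"
      unfolding tendsto_MInfty
    proof
      fix r
      have "elog y < ereal r" if "y < exp r" for y
        using that by (auto simp: elog_def) (metis exp_less_cancel_iff exp_ln not_le)
      moreover have "\<forall>\<^sub>F y in at 0. y < exp r"
        by (intro order_tendstoD(2)[OF tendsto_ident_at]) auto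
      ultimately show "\<forall>\<^sub>F y in at 0. elog y < ereal r"
        by (auto elim: eventually_mono)
    qed
    then show ?thesis using 2 by (simp add: isCont_def elog_def)
  next
    case 3
    have "isCont (\<lambda>y. ereal (ln y)) x" using 3 by (intro continuous_intros) auto
    moreover have "\<forall>\<^sub>F y in nhds x. elog y = ereal (ln y)"
      using 3 by (auto simp: elog_def intro!: eventually_nhds_in_open[THEN eventually_mono, of "{0<..}"])
    ultimately show ?thesis by (simp add: isCont_cong)
  qed
qed

lemma borel_measurable_elog [measurable]: "elog \<in> borel_measurable borel"
  by (intro borel_measurable_continuous_onI continuous_at_imp_continuous_on) (auto simp: isCont_elog)

text \<open>After division by the mean \<open>m\<close>, the bound \<open>ln z \<le> z - 1\<close>
  applies to \<open>x / m\<close> and \<open>y / m\<close>. The weighted average of the right-hand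
  sides is \<open>0\<close>, and \<open>x / m \<noteq> 1\<close> makes one bound strict.\<close>

lemma ln_convex_comb_less:
  fixes x y u :: real
  assumes "0 < x" "0 < y" "0 < u" "u < 1" "x \<noteq> y"
  shows "(1 - u) * ln x + u * ln y < ln ((1 - u) * x + u * y)"
proof -
  define m where "m = (1 - u) * x + u * y"
  have m: "0 < m" unfolding m_def using assms by (intro add_pos_pos mult_pos_pos) auto
  have ne: "x / m \<noteq> 1"
  proof
    assume "x / m = 1"
    then have "u * (y - x) = 0" using m by (simp add: m_def algebra_simps)
    then show False using assms by auto
  qed
  have "0 < x / m" using assms m by simp
  from ln_le_minus_one[OF this] ln_eq_minus_one[OF this] ne
  have lx: "ln (x / m) < x / m - 1"
    unfolding order_less_le by blast
  have ly: "ln (y / m) \<le> y / m - 1"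
    using assms m by (intro ln_le_minus_one) auto
  have "(1 - u) * ln (x / m) + u * ln (y / m) < (1 - u) * (x / m - 1) + u * (y / m - 1)"
    using lx ly assms by (intro add_less_le_mono mult_strict_left_mono mult_left_mono) auto
  also have "\<dots> = ((1 - u) * x + u * y) / m - 1" using m by (simp add: field_simps)
  also have "\<dots> = 0" using m by (simp add: m_def)
  finally show ?thesis using assms m unfolding m_def[symmetric]
    by (simp add: ln_div algebra_simps)
qed

lemma ln_convex_comb_le:
  fixes x y u :: real
  assumes "0 < x" "0 < y" "0 < u" "u < 1"
  shows "(1 - u) * ln x + u * ln y \<le> ln ((1 - u) * x + u * y)"
  using ln_convex_comb_less[OF assms] assms by (cases "x = y") (auto simp: algebra_simps)

text \<open>Derivatives are taken with respect to full neighbourhoods; openness of \<open>S\<close>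
  keeps these inside the set where the functions agree. It allows replacing
  \<open>real_of_ereal (g_fun f a)\<close> by an explicit integral on
  \<open>K_set f\<close>.\<close>

lemma times_differentiable_on_cong:
  assumes "open S" "\<And>x. x \<in> S \<Longrightarrow> h x = h' x"
  shows "times_differentiable_on k h S \<longleftrightarrow> times_differentiable_on k h' S"
  using assms(2)
proof (induction k arbitrary: h h')
  case 0
  then show ?case by (simp cong: continuous_on_cong)
next
  case (Suc k)
  have hd: "(h has_derivative D) (at x) \<longleftrightarrow> (h' has_derivative D) (at x)" if "x \<in> S" for x D
    using that Suc.prems assms(1) 
    by (metis has_derivative_transform_within_open)
  have "times_differentiable_on k (\<lambda>x. frechet_derivative h (at x) v) S \<longleftrightarrow>
        times_differentiable_on k (\<lambda>x. frechet_derivative h' (at x) v) S" for v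
    by (intro Suc.IH) (simp add: frechet_derivative_def hd)
  then show ?case using hd by (auto simp: differentiable_def)
qed

section \<open>The feasible set and the functional of a continuous path\<close>

locale continuous_path =
  fixes f :: "real \<Rightarrow> 'v::euclidean_space"
  assumes cont: "continuous_on {0..1} f"
begin

lemma cont_affine: "continuous_on {0..1} (\<lambda>t. 1 + y \<bullet> f t)"
  by (intro continuous_intros cont)

lemma affine_attains_inf:
  obtains s where "s \<in> {0..1}" "(INF t\<in>{0..1}. 1 + y \<bullet> f t) = 1 + y \<bullet> f s"
    "\<And>t. t \<in> {0..1} \<Longrightarrow> 1 + y \<bullet> f s \<le> 1 + y \<bullet> f t"
proof -
  obtain s where s: "s \<in> {0..1}" "\<And>t. t \<in> {0..1} \<Longrightarrow> 1 + y \<bullet> f s \<le> 1 + y \<bullet> f t"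
    using continuous_attains_inf[OF _ _ cont_affine[of y]] by auto
  then have "(INF t\<in>{0..1}. 1 + y \<bullet> f t) = 1 + y \<bullet> f s"
    by (intro cInf_eq_minimum) auto
  with s that show thesis by blast
qed

lemma K_set_iff: "y \<in> K_set f \<longleftrightarrow> (\<forall>t\<in>{0..1}. 0 < 1 + y \<bullet> f t)"
proof -
  obtain s where s: "s \<in> {0..1}" "(INF t\<in>{0..1}. 1 + y \<bullet> f t) = 1 + y \<bullet> f s"
    "\<And>t. t \<in> {0..1} \<Longrightarrow> 1 + y \<bullet> f s \<le> 1 + y \<bullet> f t"
    using affine_attains_inf[of y] by blast
  then show ?thesis unfolding K_set_def mem_Collect_eq s(2) by (blast intro: order_less_le_trans)
qed

lemma Kbar_set_iff: "y \<in> Kbar_set f \<longleftrightarrow> (\<forall>t\<in>{0..1}. 0 \<le> 1 + y \<bullet> f t)"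
proof -
  obtain s where s: "s \<in> {0..1}" "(INF t\<in>{0..1}. 1 + y \<bullet> f t) = 1 + y \<bullet> f s"
    "\<And>t. t \<in> {0..1} \<Longrightarrow> 1 + y \<bullet> f s \<le> 1 + y \<bullet> f t"
    using affine_attains_inf[of y] by blast
  then show ?thesis unfolding Kbar_set_def mem_Collect_eq s(2) by (blast intro: order_trans)
qed

lemma K_subset_Kbar: "K_set f \<subseteq> Kbar_set f"
  by (auto simp: K_set_iff Kbar_set_iff less_imp_le)

lemma zero_in_K: "0 \<in> K_set f"
  by (simp add: K_set_iff)

lemma path_bounded:
  obtains C where "0 < C" "\<And>t. t \<in> {0..1} \<Longrightarrow> norm (f t) \<le> C"
proof -
  have "bounded (f ` {0..1})"
    by (intro compact_imp_bounded compact_continuous_image cont) auto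
  then show thesis using that by (force simp: bounded_pos)
qed

lemma open_K: "open (K_set f)"
  unfolding open_dist
proof
  fix y assume y: "y \<in> K_set f"
  obtain C where C: "0 < C" "\<And>t. t \<in> {0..1} \<Longrightarrow> norm (f t) \<le> C"
    using path_bounded by blast
  obtain s where s: "s \<in> {0..1}" "\<And>t. t \<in> {0..1} \<Longrightarrow> 1 + y \<bullet> f s \<le> 1 + y \<bullet> f t"
    using continuous_attains_inf[OF _ _ cont_affine[of y]] by auto
  have d: "0 < 1 + y \<bullet> f s" using y s(1) by (simp add: K_set_iff)
  \<comment> \<open>\<open>1 + y \<bullet> f s\<close> is the minimum along the path and
    \<open>C\<close> is a common Lipschitz constant of the maps taking \<open>y\<close> to
    \<open>y \<bullet> f t\<close>.\<close>
  have "z \<in> K_set f" if z: "dist z y < (1 + y \<bullet> f s) / C" for z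
    unfolding K_set_iff
  proof
    fix t :: real assume t: "t \<in> {0..1}"
    have "\<bar>(z - y) \<bullet> f t\<bar> \<le> norm (z - y) * norm (f t)" by (rule Cauchy_Schwarz_ineq2)
    also have "\<dots> \<le> norm (z - y) * C" using C(2)[OF t] by (intro mult_left_mono) auto
    also have "\<dots> < 1 + y \<bullet> f s" using z C(1) by (simp add: dist_norm pos_less_divide_eq)
    finally show "0 < 1 + z \<bullet> f t" using s(2)[OF t] by (simp add: inner_diff_left)
  qed
  then show "\<exists>e>0. \<forall>z. dist z y < e \<longrightarrow> z \<in> K_set f"
    using d C(1) by (intro exI[of _ "(1 + y \<bullet> f s) / C"]) auto
qed

lemma convex_comb_affine:
  "1 + ((1 - u) *\<^sub>R x + u *\<^sub>R y) \<bullet> v = (1 - u) * (1 + x \<bullet> v) + u * (1 + y \<bullet> v)"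
  by (simp add: inner_add_left algebra_simps)

lemma convex_K: "convex (K_set f)"
  unfolding convex_alt
proof (intro ballI allI impI)
  fix x y u assume a: "x \<in> K_set f" "y \<in> K_set f" "0 \<le> u \<and> u \<le> (1::real)"
  show "(1 - u) *\<^sub>R x + u *\<^sub>R y \<in> K_set f"
    unfolding K_set_iff convex_comb_affine
  proof
    fix t :: real assume "t \<in> {0..1}"
    then have "0 < 1 + x \<bullet> f t" "0 < 1 + y \<bullet> f t" using a by (auto simp: K_set_iff)
    then show "0 < (1 - u) * (1 + x \<bullet> f t) + u * (1 + y \<bullet> f t)"
      using a(3) by (cases "u = 0") (auto intro!: add_nonneg_pos mult_nonneg_nonneg mult_pos_pos)
  qed
qed

lemma convex_Kbar: "convex (Kbar_set f)"
  unfolding convex_alt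
proof (intro ballI allI impI)
  fix x y u assume a: "x \<in> Kbar_set f" "y \<in> Kbar_set f" "0 \<le> u \<and> u \<le> (1::real)"
  then show "(1 - u) *\<^sub>R x + u *\<^sub>R y \<in> Kbar_set f"
    unfolding Kbar_set_iff convex_comb_affine by (auto intro!: add_nonneg_nonneg mult_nonneg_nonneg)
qed

lemma closed_Kbar: "closed (Kbar_set f)"
proof -
  have "Kbar_set f = (\<Inter>t\<in>{0..1}. {y. 0 \<le> 1 + y \<bullet> f t})" by (auto simp: Kbar_set_iff)
  moreover have "closed \<dots>" 
    by (intro closed_INT ballI closed_Collect_le continuous_intros)
  ultimately show ?thesis by simp
qed

text \<open>The affine function at \<open>s *\<^sub>R y\<close> is the mixture of its value
  \<open>1\<close> at the origin and its value at \<open>y\<close>, hence at least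
  \<open>1 - s\<close> at all times.\<close>

lemma scaleR_Kbar_in_K:
  assumes "y \<in> Kbar_set f" "0 \<le> s" "s < 1"
  shows "s *\<^sub>R y \<in> K_set f"
  unfolding K_set_iff
proof
  fix t :: real assume "t \<in> {0..1}"
  then have "0 \<le> 1 + y \<bullet> f t" using assms by (auto simp: Kbar_set_iff)
  then have "0 < (1 - s) + s * (1 + y \<bullet> f t)" using assms by (intro add_pos_nonneg) auto
  then show "0 < 1 + (s *\<^sub>R y) \<bullet> f t" by (simp add: algebra_simps)
qed

lemma Kbar_eq_closure_K: "Kbar_set f = closure (K_set f)"
proof
  show "closure (K_set f) \<subseteq> Kbar_set f"
    by (intro closure_minimal K_subset_Kbar closed_Kbar)
  show "Kbar_set f \<subseteq> closure (K_set f)"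
  proof
    fix y assume y: "y \<in> Kbar_set f"
    have "(\<lambda>n. (1 - inverse (real (Suc n))) *\<^sub>R y) \<longlonglongrightarrow> (1 - 0) *\<^sub>R y"
      by (intro tendsto_intros LIMSEQ_inverse_real_of_nat)
    moreover have "(1 - inverse (real (Suc n))) *\<^sub>R y \<in> K_set f" for n
      by (intro scaleR_Kbar_in_K y) (auto simp: field_simps)
    ultimately show "y \<in> closure (K_set f)"
      unfolding closure_sequential diff_zero scaleR_one
      by (intro exI[of _ "\<lambda>n. (1 - inverse (real (Suc n))) *\<^sub>R y"]) auto
  qed
qed

section \<open>Points of finite value\<close>

lemma measurable_affine [measurable]: "(\<lambda>t. 1 + a \<bullet> f t) \<in> borel_measurable unit_lborel"
  by (rule continuous_on_imp_measurable_unit[OF cont_affine])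

lemma measurable_inner_path [measurable]: "(\<lambda>t. a \<bullet> f t) \<in> borel_measurable unit_lborel"
  by (intro continuous_on_imp_measurable_unit continuous_intros cont)

lemma integrable_inner_path: "integrable unit_lborel (\<lambda>t. a \<bullet> f t)"
  by (intro continuous_on_imp_integrable_unit continuous_intros cont)

lemma integral_inner_path: "(\<integral>t. a \<bullet> f t \<partial>unit_lborel) = a \<bullet> (\<integral>t. f t \<partial>unit_lborel)"
  by (intro integral_inner_right continuous_on_imp_integrable_unit cont)

text \<open>The effective domain of \<open>g_fun f\<close>, boundary points included. Since
  \<open>ln\<close> is a total real function, integrability alone would not exclude nonpositive
  arguments on a set of positive measure.\<close>

definition log_integrable :: "'v \<Rightarrow> bool" where
  "log_integrable a \<longleftrightarrow> (AE t in unit_lborel. 0 < 1 + a \<bullet> f t) \<and>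
     integrable unit_lborel (\<lambda>t. ln (1 + a \<bullet> f t))"

lemma g_fun_eq:
  assumes "log_integrable a"
  shows "g_fun f a = ereal (- (\<integral>t. ln (1 + a \<bullet> f t) \<partial>unit_lborel))"
proof -
  let ?l = "\<lambda>t. ln (1 + a \<bullet> f t)"
  have int: "integrable unit_lborel ?l" and pos: "AE t in unit_lborel. 0 < 1 + a \<bullet> f t"
    using assms by (auto simp: log_integrable_def)
  have 1: "(\<integral>\<^sup>+t. e2ennreal (elog (1 + a \<bullet> f t)) \<partial>unit_lborel) = (\<integral>\<^sup>+t. ennreal (?l t) \<partial>unit_lborel)"
    using pos by (intro nn_integral_cong_AE) (auto simp: elog_def)
  have 2: "(\<integral>\<^sup>+t. e2ennreal (- elog (1 + a \<bullet> f t)) \<partial>unit_lborel) = (\<integral>\<^sup>+t. ennreal (- ?l t) \<partial>unit_lborel)"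
    using pos by (intro nn_integral_cong_AE) (auto simp: elog_def)
  have "(\<integral>\<^sup>+t. ennreal (?l t) \<partial>unit_lborel) \<noteq> \<infinity>" "(\<integral>\<^sup>+t. ennreal (- ?l t) \<partial>unit_lborel) \<noteq> \<infinity>"
    using int by (auto simp: real_integrable_def)
  then show ?thesis
    unfolding g_fun_def ereal_integral_def 1 2 real_lebesgue_integral_def[OF int]
    by (cases "\<integral>\<^sup>+t. ennreal (?l t) \<partial>unit_lborel"; cases "\<integral>\<^sup>+t. ennreal (- ?l t) \<partial>unit_lborel")
       (auto simp: enn2ereal_ennreal)
qed

text \<open>The positive part always has a finite integral, so a finite value forces the negative
  part to be integrable and in particular finite almost everywhere, which gives
  \<open>0 < 1 + a \<bullet> f t\<close> almost everywhere.\<close>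

lemma log_integrable_iff: "log_integrable a \<longleftrightarrow> g_fun f a < \<infinity>"
proof
  assume "log_integrable a" then show "g_fun f a < \<infinity>" by (simp add: g_fun_eq)
next
  assume fin: "g_fun f a < \<infinity>"
  let ?l = "\<lambda>t. ln (1 + a \<bullet> f t)"
  let ?p = "\<integral>\<^sup>+t. e2ennreal (elog (1 + a \<bullet> f t)) \<partial>unit_lborel"
  let ?q = "\<integral>\<^sup>+t. e2ennreal (- elog (1 + a \<bullet> f t)) \<partial>unit_lborel"
  have p: "?p < \<infinity>" by (rule elog_positive_part_finite[OF cont])
  have q: "?q \<noteq> \<infinity>"
  proof
    assume "?q = \<infinity>"
    then have "g_fun f a = \<infinity>"
      using p unfolding g_fun_def ereal_integral_def by (cases ?p) (auto simp: enn2ereal_ennreal)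
    then show False using fin by simp
  qed
  have "AE t in unit_lborel. e2ennreal (- elog (1 + a \<bullet> f t)) \<noteq> \<infinity>"
    using q by (intro nn_integral_PInf_AE) auto
  then have pos: "AE t in unit_lborel. 0 < 1 + a \<bullet> f t"
    by (rule AE_mp) (auto simp: elog_def intro!: AE_I2 split: if_splits)
  have 1: "?p = (\<integral>\<^sup>+t. ennreal (?l t) \<partial>unit_lborel)"
    using pos by (intro nn_integral_cong_AE) (auto simp: elog_def)
  have 2: "?q = (\<integral>\<^sup>+t. ennreal (- ?l t) \<partial>unit_lborel)"
    using pos by (intro nn_integral_cong_AE) (auto simp: elog_def)
  show "log_integrable a"
    unfolding log_integrable_def real_integrable_def using pos p q 1 2 by auto
qed

lemma log_integrable_K:
  assumes "a \<in> K_set f"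
  shows "log_integrable a"
  unfolding log_integrable_def
  using assms by (auto simp: K_set_iff intro!: AE_I2 continuous_on_imp_integrable_unit continuous_intros cont)

lemma g_fun_zero: "g_fun f 0 = 0"
  using g_fun_eq[OF log_integrable_K[OF zero_in_K]] by simp

lemma convex_comb_ln_le:
  assumes "0 < 1 + a \<bullet> v" "0 < 1 + b \<bullet> v" "0 < u" "u < 1"
  shows "(1 - u) * ln (1 + a \<bullet> v) + u * ln (1 + b \<bullet> v) \<le> ln (1 + ((1 - u) *\<^sub>R a + u *\<^sub>R b) \<bullet> v)"
  unfolding convex_comb_affine by (intro ln_convex_comb_le assms)

lemma log_integrable_convex_comb:
  assumes "log_integrable a" "log_integrable b" "0 < u" "u < 1"
  shows "log_integrable ((1 - u) *\<^sub>R a + u *\<^sub>R b)"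
proof -
  let ?c = "(1 - u) *\<^sub>R a + u *\<^sub>R b"
  have pos: "AE t in unit_lborel. 0 < 1 + a \<bullet> f t" "AE t in unit_lborel. 0 < 1 + b \<bullet> f t"
    and int: "integrable unit_lborel (\<lambda>t. ln (1 + a \<bullet> f t))" "integrable unit_lborel (\<lambda>t. ln (1 + b \<bullet> f t))"
    using assms by (auto simp: log_integrable_def)
  have cpos: "AE t in unit_lborel. 0 < 1 + ?c \<bullet> f t"
    using pos unfolding convex_comb_affine
    by eventually_elim (use assms in \<open>auto intro!: add_pos_pos mult_pos_pos\<close>)
  moreover have "integrable unit_lborel (\<lambda>t. ln (1 + ?c \<bullet> f t))"
  proof (rule Bochner_Integration.integrable_bound)
    \<comment> \<open>The first term bounds the logarithm from above, by
      \<open>ln z \<le> z - 1\<close>; the second bounds it from below, by concavity.\<close>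
    show "integrable unit_lborel (\<lambda>t. \<bar>?c \<bullet> f t\<bar> +
        \<bar>(1 - u) * ln (1 + a \<bullet> f t) + u * ln (1 + b \<bullet> f t)\<bar>)"
      by (intro Bochner_Integration.integrable_add integrable_abs integrable_inner_path integrable_mult_right int)
    show "AE t in unit_lborel. norm (ln (1 + ?c \<bullet> f t)) \<le> norm (\<bar>?c \<bullet> f t\<bar> +
        \<bar>(1 - u) * ln (1 + a \<bullet> f t) + u * ln (1 + b \<bullet> f t)\<bar>)"
      using pos cpos
    proof eventually_elim
      case (elim t)
      have "ln (1 + ?c \<bullet> f t) \<le> 1 + ?c \<bullet> f t - 1" using elim by (intro ln_le_minus_one)
      with convex_comb_ln_le[of a "f t" b u] elim assms show ?case by auto
    qed
  qed measurable
  ultimately show ?thesis by (simp add: log_integrable_def)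
qed

section \<open>Smoothness of the functional\<close>

lemma continuous_on_comp_affine:
  fixes \<phi> :: "real \<Rightarrow> real"
  assumes "continuous_on {0<..} \<phi>" "a \<in> K_set f"
  shows "continuous_on {0..1} (\<lambda>t. \<phi> (1 + a \<bullet> f t))"
  using assms(2) by (intro continuous_on_compose2[OF assms(1) cont_affine]) (auto simp: K_set_iff)

text \<open>The Leibniz rule on the convex set \<open>K_set f\<close>, with the derivative packaged
  as a bounded linear function. The weight \<open>p\<close> is there for iteration: differentiating
  in direction \<open>v\<close> multiplies it by \<open>v \<bullet> f t\<close>.\<close>

lemma has_derivative_integral_path:
  fixes \<phi> \<phi>' p :: "real \<Rightarrow> real"
  assumes p: "continuous_on {0..1} p"
    and \<phi>: "\<And>x. 0 < x \<Longrightarrow> (\<phi> has_real_derivative \<phi>' x) (at x)"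
    and \<phi>': "continuous_on {0<..} \<phi>'"
    and a: "a \<in> K_set f"
  shows "((\<lambda>a. integral {0..1} (\<lambda>t. p t * \<phi> (1 + a \<bullet> f t))) has_derivative
          (\<lambda>v. integral {0..1} (\<lambda>t. p t * (v \<bullet> f t) * \<phi>' (1 + a \<bullet> f t)))) (at a)"
proof -
  let ?D = "\<lambda>a t. (p t * \<phi>' (1 + a \<bullet> f t)) *\<^sub>R blinfun_inner_left (f t)"
  have c\<phi>: "continuous_on {0<..} \<phi>"
    using \<phi> by (intro continuous_at_imp_continuous_on ballI DERIV_isCont) auto
  have "((\<lambda>a. integral (cbox 0 1) (\<lambda>t. p t * \<phi> (1 + a \<bullet> f t))) has_derivative
      integral (cbox 0 1) (?D a)) (at a within K_set f)"
  proof (rule leibniz_rule[OF _ _ _ a convex_K])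
    fix x t assume x: "x \<in> K_set f" and t: "t \<in> cbox 0 (1::real)"
    have "((\<lambda>a. 1 + a \<bullet> f t) has_derivative (\<lambda>v. v \<bullet> f t)) (at x within K_set f)"
      by (auto intro!: derivative_eq_intros)
    moreover have "(\<phi> has_real_derivative \<phi>' (1 + x \<bullet> f t)) (at (1 + x \<bullet> f t))"
      using x t by (intro \<phi>) (auto simp: K_set_iff)
    ultimately have "((\<lambda>a. \<phi> (1 + a \<bullet> f t)) has_derivative (\<lambda>v. (v \<bullet> f t) * \<phi>' (1 + x \<bullet> f t)))
        (at x within K_set f)"
      by (rule DERIV_compose_FDERIV[rotated])
    then have "((\<lambda>a. p t * \<phi> (1 + a \<bullet> f t)) has_derivative (\<lambda>v. p t * ((v \<bullet> f t) * \<phi>' (1 + x \<bullet> f t))))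
        (at x within K_set f)"
      by (rule has_derivative_mult_right)
    then show "((\<lambda>a. p t * \<phi> (1 + a \<bullet> f t)) has_derivative blinfun_apply (?D x t)) (at x within K_set f)"
      by (rule has_derivative_eq_rhs) (auto simp: blinfun.bilinear_simps)
  next
    fix x assume "x \<in> K_set f"
    then show "(\<lambda>t. p t * \<phi> (1 + x \<bullet> f t)) integrable_on cbox 0 1"
      by (intro integrable_continuous continuous_on_mult)
        (auto intro: continuous_on_comp_affine[OF c\<phi>] p)
  next
    have "continuous_on (K_set f \<times> {0..1}) (\<lambda>z. f (snd z))"
      by (rule continuous_on_compose2[OF cont continuous_on_snd]) (auto intro: continuous_on_id)
    moreover have "continuous_on (K_set f \<times> {0..1}) (\<lambda>z. p (snd z))"
      by (rule continuous_on_compose2[OF p continuous_on_snd]) (auto intro: continuous_on_id)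
    moreover have "continuous_on (K_set f \<times> {0..1}) (\<lambda>z. \<phi>' (1 + fst z \<bullet> f (snd z)))"
      by (rule continuous_on_compose2[OF \<phi>'])
         (auto intro!: continuous_intros calculation(1) simp: K_set_iff)
    ultimately show "continuous_on (K_set f \<times> cbox 0 1) (\<lambda>(x, t). ?D x t)"
      unfolding split_beta cbox_interval
      by (intro continuous_intros bounded_linear.continuous_on[OF bounded_linear_blinfun_inner_left])
  qed
  moreover have "?D a integrable_on cbox 0 1"
    using a by (intro integrable_continuous continuous_intros p cont continuous_on_comp_affine[OF \<phi>']
      bounded_linear.continuous_on[OF bounded_linear_blinfun_inner_left]) (auto intro: p cont continuous_on_comp_affine[OF \<phi>'])
  then have "blinfun_apply (integral (cbox 0 1) (?D a)) =
      (\<lambda>v. integral {0..1} (\<lambda>t. p t * (v \<bullet> f t) * \<phi>' (1 + a \<bullet> f t)))"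
    by (auto simp: fun_eq_iff blinfun_apply_integral blinfun.bilinear_simps mult_ac)
  ultimately show ?thesis
    by (simp add: at_within_open[OF a open_K])
qed

text \<open>This family is closed under directional derivatives: direction \<open>v\<close> turns
  the weight \<open>p t\<close> into \<open>p t * (v \<bullet> f t) * (- real m)\<close> and the
  exponent \<open>m\<close> into \<open>Suc m\<close>. Hence the induction generalises over
  both.\<close>

lemma times_differentiable_integral_power:
  assumes "continuous_on {0..1} p"
  shows "times_differentiable_on k (\<lambda>a. integral {0..1} (\<lambda>t. p t * inverse (1 + a \<bullet> f t) ^ m)) (K_set f)"
  using assms
proof (induction k arbitrary: p m)
  have D: "((\<lambda>x. inverse x ^ m) has_real_derivative - real m * inverse x ^ Suc m) (at x)" if "0 < x" for x m
  proof (cases m)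
    case (Suc j)
    have "(inverse has_real_derivative - (inverse x ^ Suc (Suc 0))) (at x)"
      using that by (intro DERIV_inverse) auto
    from DERIV_power_Suc[OF this, of j] show ?thesis
      unfolding Suc by (rule DERIV_cong) (simp add: algebra_simps)
  qed simp
  have C: "continuous_on {0<..} (\<lambda>x. - real m * inverse x ^ Suc m)" for m
    by (intro continuous_intros) auto
  note hd = has_derivative_integral_path[OF _ D C]
  {
    case 0
    then show ?case
      by (auto intro!: continuous_at_imp_continuous_on has_derivative_continuous[OF hd])
  next
    case (Suc k)
    have "times_differentiable_on k (\<lambda>x. frechet_derivative
        (\<lambda>a. integral {0..1} (\<lambda>t. p t * inverse (1 + a \<bullet> f t) ^ m)) (at x) v) (K_set f)" for v
    proof -
      have "times_differentiable_on k (\<lambda>x. integral {0..1}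
          (\<lambda>t. (p t * (v \<bullet> f t) * (- real m)) * inverse (1 + x \<bullet> f t) ^ Suc m)) (K_set f)"
        by (intro Suc.IH continuous_intros cont Suc.prems)
      then show ?thesis
        by (subst times_differentiable_on_cong[OF open_K])
           (auto simp: mult.assoc simp flip: frechet_derivative_at[OF hd[OF Suc.prems]])
    qed
    then show ?case using hd[OF Suc.prems] by (auto simp: differentiable_def)
  }
qed

text \<open>The real form of \<open>g_fun f\<close> on \<open>K_set f\<close>. The factor
  \<open>- 1\<close> is the weight \<open>p\<close> of
  \<open>has_derivative_integral_path\<close>.\<close>

definition g_real :: "'v \<Rightarrow> real" where
  "g_real a = integral {0..1} (\<lambda>t. - 1 * ln (1 + a \<bullet> f t))"

lemma g_fun_K:
  assumes "a \<in> K_set f"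
  shows "g_fun f a = ereal (g_real a)"
  using assms
  by (subst g_fun_eq[OF log_integrable_K[OF assms]], subst integral_unit_lborel)
     (auto simp: g_real_def K_set_iff intro!: continuous_intros cont)

lemma g_real_has_derivative:
  assumes "a \<in> K_set f"
  shows "(g_real has_derivative (\<lambda>v. integral {0..1} (\<lambda>t. (- 1 * (v \<bullet> f t)) * inverse (1 + a \<bullet> f t)))) (at a)"
  unfolding g_real_def
  by (rule has_derivative_integral_path[OF _ _ _ assms])
     (auto intro!: continuous_intros derivative_eq_intros simp: divide_inverse)

text \<open>The logarithm is not an inverse power, so one derivative is taken by hand; it belongs to
  the family of \<open>times_differentiable_integral_power\<close> with exponent
  \<open>1\<close>.\<close>

lemma g_infinitely_differentiable:
  "infinitely_differentiable_on (\<lambda>a. real_of_ereal (g_fun f a)) (K_set f)"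
  unfolding infinitely_differentiable_on_def
proof
  fix k
  have "times_differentiable_on k g_real (K_set f)"
  proof (cases k)
    case 0
    then show ?thesis
      by (auto intro!: continuous_at_imp_continuous_on has_derivative_continuous[OF g_real_has_derivative])
  next
    case (Suc j)
    have "times_differentiable_on j (\<lambda>x. frechet_derivative g_real (at x) v) (K_set f)" for v
    proof -
      have "times_differentiable_on j (\<lambda>x. integral {0..1}
          (\<lambda>t. (- 1 * (v \<bullet> f t)) * inverse (1 + x \<bullet> f t) ^ 1)) (K_set f)"
        by (intro times_differentiable_integral_power continuous_intros cont)
      then show ?thesis
        by (subst times_differentiable_on_cong[OF open_K])
           (auto simp flip: frechet_derivative_at[OF g_real_has_derivative])
    qed
    then show ?thesis using Suc g_real_has_derivative by (auto simp: differentiable_def)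
  qed
  then show "times_differentiable_on k (\<lambda>a. real_of_ereal (g_fun f a)) (K_set f)"
    by (subst times_differentiable_on_cong[OF open_K]) (auto simp: g_fun_K)
qed

text \<open>A convergent sequence is bounded, so the positive parts of the logarithms are dominated
  and their integrals converge. The negative parts admit only Fatou's inequality, which has the
  right direction because of the minus sign in \<open>g_fun\<close>.\<close>

lemma g_fun_lower_semicontinuous:
  assumes X: "X \<longlonglongrightarrow> a" and m: "(\<lambda>n. g_fun f (X n)) \<longlonglongrightarrow> m"
  shows "g_fun f a \<le> m"
proof -
  define p where "p = (\<lambda>a. \<integral>\<^sup>+t. e2ennreal (elog (1 + a \<bullet> f t)) \<partial>unit_lborel)"
  define q where "q = (\<lambda>a. \<integral>\<^sup>+t. e2ennreal (- elog (1 + a \<bullet> f t)) \<partial>unit_lborel)"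
  have g: "g_fun f a = - (enn2ereal (p a) - enn2ereal (q a))" for a
    by (simp add: g_fun_def ereal_integral_def p_def q_def)
  have pfin: "p a < \<infinity>" for a unfolding p_def by (rule elog_positive_part_finite[OF cont])
  have p_real: "\<bar>enn2ereal (p a)\<bar> \<noteq> \<infinity>" for a using pfin[of a]
    by (cases "p a") (auto simp: enn2ereal_ennreal)
  have lim: "(\<lambda>n. elog (1 + X n \<bullet> f t)) \<longlonglongrightarrow> elog (1 + a \<bullet> f t)" for t
    by (intro isCont_tendsto_compose[OF isCont_elog] tendsto_intros X)
  obtain C where C: "0 < C" "\<And>t. t \<in> {0..1} \<Longrightarrow> norm (f t) \<le> C"
    using path_bounded by blast
  obtain R where R: "0 < R" "\<And>n. norm (X n) \<le> R"
    using X convergent_imp_Bseq[of X] by (auto simp: convergent_def Bseq_def)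
  have "(\<lambda>n. p (X n)) \<longlonglongrightarrow> p a"
    unfolding p_def
  proof (rule nn_integral_dominated_convergence)
    show "AE t in unit_lborel. e2ennreal (elog (1 + X n \<bullet> f t)) \<le> ennreal (R * C)" for n
    proof (rule AE_I2)
      fix t assume "t \<in> space unit_lborel"
      then have "\<bar>X n \<bullet> f t\<bar> \<le> R * C"
        using C R by (intro order_trans[OF Cauchy_Schwarz_ineq2] mult_mono) (auto simp: less_imp_le)
      then show "e2ennreal (elog (1 + X n \<bullet> f t)) \<le> ennreal (R * C)"
        using ln_le_minus_one[of "1 + X n \<bullet> f t"]
        by (auto simp: elog_def e2ennreal_neg intro!: ennreal_leI)
    qed
    show "(\<integral>\<^sup>+t. ennreal (R * C) \<partial>unit_lborel) < \<infinity>"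
      using unit.emeasure_space_1 by simp
    show "AE t in unit_lborel. (\<lambda>n. e2ennreal (elog (1 + X n \<bullet> f t))) \<longlonglongrightarrow> e2ennreal (elog (1 + a \<bullet> f t))"
      by (intro AE_I2 tendsto_e2ennrealI lim)
  qed measurable
  then have pl: "(\<lambda>n. enn2ereal (p (X n))) \<longlonglongrightarrow> enn2ereal (p a)"
    by (intro tendsto_enn2erealI)
  have "q a = (\<integral>\<^sup>+t. liminf (\<lambda>n. e2ennreal (- elog (1 + X n \<bullet> f t))) \<partial>unit_lborel)"
    unfolding q_def
    by (intro nn_integral_cong lim_imp_Liminf[symmetric] tendsto_e2ennrealI tendsto_uminus_ereal lim) simp
  also have "\<dots> \<le> liminf (\<lambda>n. q (X n))"
    unfolding q_def by (rule nn_integral_liminf) measurable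
  finally have ql: "q a \<le> liminf (\<lambda>n. q (X n))" .
  \<comment> \<open>Adding the finite positive part avoids differences of extended reals, since
    \<open>g_fun f b\<close>, \<open>q b\<close> and \<open>m\<close> may be infinite.\<close>
  have gq: "g_fun f b + enn2ereal (p b) = enn2ereal (q b)" for b
    unfolding g using p_real[of b] by (cases "enn2ereal (p b)"; cases "enn2ereal (q b)") auto
  have "(\<lambda>n. g_fun f (X n) + enn2ereal (p (X n))) \<longlonglongrightarrow> m + enn2ereal (p a)"
    by (rule tendsto_add_ereal_general1[OF p_real m pl])
  then have ql2: "(\<lambda>n. enn2ereal (q (X n))) \<longlonglongrightarrow> m + enn2ereal (p a)" by (simp add: gq)
  \<comment> \<open>\<open>e2ennreal\<close> truncates at \<open>0\<close>; the sign is what allows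
    going back to \<open>ereal\<close>.\<close>
  then have nonneg: "0 \<le> m + enn2ereal (p a)" by (rule LIMSEQ_le_const) auto
  from tendsto_e2ennrealI[OF ql2] have "liminf (\<lambda>n. q (X n)) = e2ennreal (m + enn2ereal (p a))"
    by (intro lim_imp_Liminf) auto
  with ql have "enn2ereal (q a) \<le> m + enn2ereal (p a)"
    using nonneg by (simp add: less_eq_ennreal.rep_eq enn2ereal_e2ennreal)
  then show ?thesis
    unfolding g using p_real[of a] by (cases "enn2ereal (p a)"; cases "enn2ereal (q a)"; cases m) auto
qed

end

text \<open>By separation, \<open>neg\<close> says that \<open>0\<close> is an interior point of the
  convex hull of the path. In particular no hyperplane through the origin contains the path.\<close>

locale spanning_path = continuous_path +
  assumes neg: "y \<noteq> 0 \<Longrightarrow> \<exists>t\<in>{0..1}. y \<bullet> f t < 0"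
begin

text \<open>Along an unbounded sequence, dividing \<open>0 \<le> 1 + y n \<bullet> f t\<close> by
  \<open>norm (y n)\<close> shows that a limit direction \<open>l\<close> satisfies
  \<open>0 \<le> l \<bullet> f t\<close> at every time, contradicting \<open>neg\<close>.\<close>

lemma bounded_Kbar: "bounded (Kbar_set f)"
proof (rule ccontr)
  assume "\<not> bounded (Kbar_set f)"
  then have "\<exists>y\<in>Kbar_set f. real n < norm y" for n :: nat
    unfolding bounded_iff by (meson not_le)
  then obtain y where y: "\<And>n. y n \<in> Kbar_set f" "\<And>n. real n < norm (y n)" by metis
  define u where "u = (\<lambda>n. y n /\<^sub>R norm (y n))"
  have ynz: "y n \<noteq> 0" for n using y(2)[of n] by auto
  have "u n \<in> sphere 0 1" for n using ynz by (simp add: u_def)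
  then obtain l r where l: "l \<in> sphere 0 1" and r: "strict_mono r" "(u \<circ> r) \<longlonglongrightarrow> l"
    using compact_sphere[of "0::'a" 1] unfolding compact_def by metis
  have "l \<noteq> 0" using l by auto
  then obtain t where t: "t \<in> {0..1}" "l \<bullet> f t < 0" using neg by blast
  have ge: "- inverse (real (Suc n)) \<le> u (Suc n) \<bullet> f t" for n
  proof -
    have "0 \<le> 1 + y (Suc n) \<bullet> f t" using y(1) t(1) by (simp add: Kbar_set_iff)
    then have "- 1 / norm (y (Suc n)) \<le> (y (Suc n) \<bullet> f t) / norm (y (Suc n))"
      by (intro divide_right_mono) auto
    moreover have "inverse (norm (y (Suc n))) \<le> inverse (real (Suc n))"
      using y(2)[of "Suc n"] by (intro le_imp_inverse_le) auto
    ultimately show ?thesis by (simp add: u_def divide_inverse mult.commute)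
  qed
  have lim: "(\<lambda>n. u (r (Suc n)) \<bullet> f t) \<longlonglongrightarrow> l \<bullet> f t"
    using LIMSEQ_Suc[OF r(2)] by (intro tendsto_intros) (simp add: o_def)
  have lim0: "(\<lambda>n. - inverse (real (Suc n))) \<longlonglongrightarrow> - 0"
    by (intro tendsto_intros LIMSEQ_inverse_real_of_nat)
  have "- inverse (real (Suc n)) \<le> u (r (Suc n)) \<bullet> f t" for n
  proof -
    have *: "Suc n \<le> r (Suc n)" using r(1) by (rule seq_suble)
    then obtain k where k: "r (Suc n) = Suc k" by (cases "r (Suc n)") auto
    have "inverse (real (Suc k)) \<le> inverse (real (Suc n))" using * k by (intro le_imp_inverse_le) auto
    then show ?thesis using ge[of k] unfolding k by linarith
  qed
  then have "- 0 \<le> l \<bullet> f t" by (intro LIMSEQ_le[OF lim0 lim]) blast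
  then show False using t by simp
qed

lemma compact_Kbar: "compact (Kbar_set f)"
  using bounded_Kbar closed_Kbar by (simp add: compact_eq_bounded_closed)

lemma bounded_K: "bounded (K_set f)"
  using bounded_Kbar K_subset_Kbar by (rule bounded_subset)

text \<open>Equality would force equality in the pointwise concavity inequality almost everywhere,
  hence \<open>(a - b) \<bullet> f t = 0\<close> at all times by continuity, against
  \<open>neg\<close>. Allowing boundary points is what makes uniqueness on all of
  \<open>Kbar_set f\<close> possible.\<close>

lemma integral_ln_convex_comb_less:
  assumes "log_integrable a" "log_integrable b" "a \<noteq> b" "0 < u" "u < 1"
  shows "(1 - u) * (\<integral>t. ln (1 + a \<bullet> f t) \<partial>unit_lborel) + u * (\<integral>t. ln (1 + b \<bullet> f t) \<partial>unit_lborel) <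
    (\<integral>t. ln (1 + ((1 - u) *\<^sub>R a + u *\<^sub>R b) \<bullet> f t) \<partial>unit_lborel)"
proof -
  let ?c = "(1 - u) *\<^sub>R a + u *\<^sub>R b"
  let ?L = "\<lambda>a t. ln (1 + a \<bullet> f t)"
  let ?D = "\<lambda>t. ?L ?c t - ((1 - u) * ?L a t + u * ?L b t)"
  note int = assms(1,2)[unfolded log_integrable_def, THEN conjunct2]
    log_integrable_convex_comb[OF assms(1,2,4,5), unfolded log_integrable_def, THEN conjunct2]
  have pos: "AE t in unit_lborel. 0 < 1 + a \<bullet> f t" "AE t in unit_lborel. 0 < 1 + b \<bullet> f t"
    using assms by (auto simp: log_integrable_def)
  have Dint: "integrable unit_lborel ?D"
    by (intro Bochner_Integration.integrable_diff Bochner_Integration.integrable_add integrable_mult_right int)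
  have D0: "AE t in unit_lborel. 0 \<le> ?D t"
    using pos by eventually_elim (use convex_comb_ln_le[of a _ b u] assms in auto)
  have Deq: "integral\<^sup>L unit_lborel ?D = integral\<^sup>L unit_lborel (?L ?c) -
      ((1 - u) * integral\<^sup>L unit_lborel (?L a) + u * integral\<^sup>L unit_lborel (?L b))"
    using int by simp
  have "integral\<^sup>L unit_lborel ?D \<noteq> 0"
  proof
    assume "integral\<^sup>L unit_lborel ?D = 0"
    then have "AE t in unit_lborel. ?D t = 0"
      using integral_nonneg_eq_0_iff_AE[OF Dint D0] by simp
    then have "AE t in unit_lborel. (a - b) \<bullet> f t = 0"
      using pos
    proof eventually_elim
      case (elim t)
      show ?case
      proof (rule ccontr)
        assume "(a - b) \<bullet> f t \<noteq> 0"
        then have "1 + a \<bullet> f t \<noteq> 1 + b \<bullet> f t" by (simp add: inner_diff_left)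
        then show False
          using ln_convex_comb_less[of "1 + a \<bullet> f t" "1 + b \<bullet> f t" u] elim assms
          unfolding convex_comb_affine by simp
      qed
    qed
    then have "(a - b) \<bullet> f t = 0" if "t \<in> {0..1}" for t
      by (intro continuous_AE_unit_eq_0[OF _ _ that] continuous_intros cont)
    then show False using neg[of "a - b"] assms(3) by force
  qed
  moreover have "0 \<le> integral\<^sup>L unit_lborel ?D" using D0 by (intro integral_nonneg_AE)
  ultimately show ?thesis unfolding Deq by simp
qed

lemma g_strictly_convex: "strictly_convex_on (K_set f) (\<lambda>a. real_of_ereal (g_fun f a))"
  unfolding strictly_convex_on_def
proof (intro conjI convex_K allI ballI impI)
  fix u :: real and x y assume a: "x \<in> K_set f" "y \<in> K_set f" "0 < u \<and> u < 1 \<and> x \<noteq> y"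
  have "(1 - u) *\<^sub>R x + u *\<^sub>R y \<in> K_set f"
    using convex_K a unfolding convex_alt by (simp add: less_imp_le)
  then show "real_of_ereal (g_fun f ((1 - u) *\<^sub>R x + u *\<^sub>R y)) <
      (1 - u) * real_of_ereal (g_fun f x) + u * real_of_ereal (g_fun f y)"
    using integral_ln_convex_comb_less[of x y u] a by (simp add: g_fun_eq log_integrable_K)
qed

section \<open>Existence, uniqueness and stability of the minimizer\<close>

definition minimizer :: "'a \<Rightarrow> bool" where
  "minimizer a \<longleftrightarrow> a \<in> Kbar_set f \<and> (\<forall>b\<in>Kbar_set f. g_fun f a \<le> g_fun f b)"

lemma minimizer_log_integrable:
  assumes "minimizer a"
  shows "log_integrable a"
proof -
  have "g_fun f a \<le> g_fun f 0"
    using assms zero_in_K K_subset_Kbar by (auto simp: minimizer_def)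
  then show ?thesis unfolding log_integrable_iff g_fun_zero by (cases "g_fun f a") auto
qed

text \<open>Both minimizers have finite value, so the midpoint would do strictly better, even if
  they lie on the boundary.\<close>

lemma minimizer_unique:
  assumes a: "minimizer a" and b: "minimizer b"
  shows "a = b"
proof (rule ccontr)
  assume ne: "a \<noteq> b"
  let ?c = "(1 - 1/2) *\<^sub>R a + (1/2) *\<^sub>R b"
  note li = minimizer_log_integrable[OF a] minimizer_log_integrable[OF b]
  have c: "?c \<in> Kbar_set f"
    using a b convexD_alt[OF convex_Kbar, of a b "1/2"] by (simp add: minimizer_def)
  have "g_fun f a \<le> g_fun f ?c" "g_fun f b \<le> g_fun f ?c" using a b c by (auto simp: minimizer_def)
  moreover have "g_fun f ?c = ereal (- (\<integral>t. ln (1 + ?c \<bullet> f t) \<partial>unit_lborel))"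
    by (intro g_fun_eq log_integrable_convex_comb li) auto
  ultimately show False
    using integral_ln_convex_comb_less[OF li ne, of "1/2"]
    unfolding g_fun_eq[OF li(1)] g_fun_eq[OF li(2)] by simp
qed

lemma minimizer_if_le:
  assumes "minimizer a" "b \<in> Kbar_set f" "g_fun f b \<le> g_fun f a"
  shows "b = a"
  using assms by (intro minimizer_unique) (auto simp: minimizer_def intro: order_trans)

lemma minimizer_exists: "\<exists>a. minimizer a"
proof -
  have "g_fun f ` Kbar_set f \<noteq> {}" using zero_in_K K_subset_Kbar by auto
  then obtain v where v: "\<And>n. v n \<in> g_fun f ` Kbar_set f" "v \<longlonglongrightarrow> Inf (g_fun f ` Kbar_set f)"
    using Inf_as_limit by metis
  then have "\<forall>n. \<exists>x\<in>Kbar_set f. v n = g_fun f x" by blast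
  then obtain X where X: "\<And>n. X n \<in> Kbar_set f" "\<And>n. v n = g_fun f (X n)" by metis
  obtain l r where l: "l \<in> Kbar_set f" and r: "strict_mono r" "(X \<circ> r) \<longlonglongrightarrow> l"
    using compact_Kbar X(1) unfolding compact_def by metis
  have "g_fun f l \<le> Inf (g_fun f ` Kbar_set f)"
    using LIMSEQ_subseq_LIMSEQ[OF v(2) r(1)]
    by (intro g_fun_lower_semicontinuous[OF r(2)]) (simp add: o_def X(2))
  then have "minimizer l"
    using l by (auto simp: minimizer_def le_Inf_iff)
  then show ?thesis by blast
qed

text \<open>A subsequence staying away from \<open>Y\<close> would have a cluster point by
  compactness; lower semicontinuity makes it a minimizer, hence equal to \<open>Y\<close>.\<close>

lemma minimizing_sequence_LIMSEQ:
  assumes Y: "minimizer Y" and X: "\<And>n. X n \<in> Kbar_set f" "(\<lambda>n. g_fun f (X n)) \<longlonglongrightarrow> g_fun f Y"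
  shows "X \<longlonglongrightarrow> Y"
proof (rule ccontr)
  assume "\<not> X \<longlonglongrightarrow> Y"
  then obtain e where e: "0 < e" "\<not> (\<forall>\<^sub>F n in sequentially. dist (X n) Y < e)"
    unfolding tendsto_iff by blast
  then obtain r :: "nat \<Rightarrow> nat" where r: "strict_mono r" "\<And>n. \<not> dist (X (r n)) Y < e"
    using not_eventually_sequentiallyD[OF e(2)] by blast
  obtain l s where l: "l \<in> Kbar_set f" and s: "strict_mono s" "((X \<circ> r) \<circ> s) \<longlonglongrightarrow> l"
    using compact_Kbar X(1) unfolding compact_def by (metis comp_apply)
  have "strict_mono (r \<circ> s)" using r s by (auto intro: strict_mono_o)
  from LIMSEQ_subseq_LIMSEQ[OF X(2) this] have "g_fun f l \<le> g_fun f Y"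
    by (intro g_fun_lower_semicontinuous[OF s(2)]) (simp add: o_def)
  with l Y have "l = Y" by (intro minimizer_if_le)
  with s(2) e(1) have "\<forall>\<^sub>F n in sequentially. dist (((X \<circ> r) \<circ> s) n) Y < e"
    by (auto dest: tendstoD)
  then show False using r(2) by (auto simp: eventually_sequentially)
qed

end

section \<open>The minimizer\<close>

text \<open>The pair carries the best point so far and its value; the start \<open>(0, 0)\<close> is
  admissible because \<open>0\<close> is feasible with value \<open>0\<close>. Feasibility
  \<open>P\<close> and values \<open>h\<close> stay abstract because they later depend on
  \<open>\<omega>\<close>, while the candidates \<open>q\<close> do not.\<close>

primrec greedy :: "(nat \<Rightarrow> bool) \<Rightarrow> (nat \<Rightarrow> real) \<Rightarrow> (nat \<Rightarrow> 'v::zero) \<Rightarrow> nat \<Rightarrow> 'v \<times> real" where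
  "greedy P h q 0 = (0, 0)"
| "greedy P h q (Suc n) =
     (if P n \<and> h n < snd (greedy P h q n) then (q n, h n) else greedy P h q n)"

context spanning_path
begin

lemma is_arg_min_iff_minimizer:
  "is_arg_min (g_fun f) (\<lambda>a. a \<in> Kbar_set f) a \<longleftrightarrow> minimizer a"
  by (auto simp: is_arg_min_def minimizer_def not_less)

section \<open>Stationary points\<close>

lemma continuous_on_quotient:
  assumes "a \<in> K_set f"
  shows "continuous_on {0..1} (\<lambda>t. f t /\<^sub>R (1 + a \<bullet> f t))"
  using assms by (intro continuous_intros cont) (auto simp: K_set_iff)

lemma inner_integral_quotient:
  assumes "a \<in> K_set f"
  shows "v \<bullet> (\<integral>t. f t /\<^sub>R (1 + a \<bullet> f t) \<partial>unit_lborel) = (\<integral>t. (v \<bullet> f t) / (1 + a \<bullet> f t) \<partial>unit_lborel)"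
    and "integrable unit_lborel (\<lambda>t. (v \<bullet> f t) / (1 + a \<bullet> f t))"
proof -
  have int: "integrable unit_lborel (\<lambda>t. f t /\<^sub>R (1 + a \<bullet> f t))"
    by (intro continuous_on_imp_integrable_unit continuous_on_quotient assms)
  have eq: "(\<lambda>t. (v \<bullet> f t) / (1 + a \<bullet> f t)) = (\<lambda>t. v \<bullet> (f t /\<^sub>R (1 + a \<bullet> f t)))"
    by (simp add: divide_inverse mult.commute)
  show "v \<bullet> (\<integral>t. f t /\<^sub>R (1 + a \<bullet> f t) \<partial>unit_lborel) = (\<integral>t. (v \<bullet> f t) / (1 + a \<bullet> f t) \<partial>unit_lborel)"
    unfolding eq by (rule integral_inner_right[OF int, symmetric])
  show "integrable unit_lborel (\<lambda>t. (v \<bullet> f t) / (1 + a \<bullet> f t))"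
    unfolding eq by (rule integrable_inner_right[OF int])
qed

lemma minimizer_imp_stationary:
  assumes m: "minimizer a" and a: "a \<in> K_set f"
  shows "stationary f a"
proof -
  let ?J = "\<integral>t. f t /\<^sub>R (1 + a \<bullet> f t) \<partial>unit_lborel"
  have "(\<lambda>v. integral {0..1} (\<lambda>t. (- 1 * (v \<bullet> f t)) * inverse (1 + a \<bullet> f t))) = (\<lambda>v. 0)"
  proof (rule differential_zero_maxmin[OF a open_K g_real_has_derivative[OF a]])
    have "g_real a \<le> g_real y" if "y \<in> K_set f" for y
      using m that K_subset_Kbar a unfolding minimizer_def by (metis ereal_less_eq(3) g_fun_K subsetD)
    then show "(\<forall>y\<in>K_set f. g_real y \<le> g_real a) \<or> (\<forall>y\<in>K_set f. g_real a \<le> g_real y)" by blast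
  qed
  \<comment> \<open>Testing the vanishing derivative in the direction of the integral
    \<open>?J\<close> itself yields \<open>?J \<bullet> ?J = 0\<close>.\<close>
  from fun_cong[OF this, of ?J]
  have "integral {0..1} (\<lambda>t. - ((?J \<bullet> f t) / (1 + a \<bullet> f t))) = 0"
    by (simp add: divide_inverse)
  then have "integral {0..1} (\<lambda>t. (?J \<bullet> f t) / (1 + a \<bullet> f t)) = 0"
    unfolding integral_neg by simp
  moreover have "(\<integral>t. (?J \<bullet> f t) / (1 + a \<bullet> f t) \<partial>unit_lborel) =
      integral {0..1} (\<lambda>t. (?J \<bullet> f t) / (1 + a \<bullet> f t))"
    using a by (intro integral_unit_lborel continuous_intros cont) (auto simp: K_set_iff)
  ultimately have "?J \<bullet> ?J = 0" using inner_integral_quotient(1)[OF a, of ?J] by simp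
  then show ?thesis using a by (simp add: stationary_def)
qed

lemma ln_difference_le:
  assumes "a \<in> K_set f" "t \<in> {0..1}" "0 < 1 + b \<bullet> f t"
  shows "ln (1 + b \<bullet> f t) - ln (1 + a \<bullet> f t) \<le> ((b - a) \<bullet> f t) / (1 + a \<bullet> f t)"
  using ln_diff_le[of "1 + b \<bullet> f t" "1 + a \<bullet> f t"] assms by (simp add: K_set_iff inner_diff_left)

text \<open>The integrated tangent inequality: the denominator involves only \<open>a\<close>, so
  \<open>b\<close> may lie on the boundary. It serves for a stationary base point, for the base
  point \<open>0\<close>, and for a shrunk minimizer.\<close>

lemma integral_ln_difference_le:
  assumes a: "a \<in> K_set f" and b: "log_integrable b"
  shows "(\<integral>t. ln (1 + b \<bullet> f t) \<partial>unit_lborel) - (\<integral>t. ln (1 + a \<bullet> f t) \<partial>unit_lborel) \<le>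
    (\<integral>t. ((b - a) \<bullet> f t) / (1 + a \<bullet> f t) \<partial>unit_lborel)"
proof -
  have ia: "integrable unit_lborel (\<lambda>t. ln (1 + a \<bullet> f t))"
    and ib: "integrable unit_lborel (\<lambda>t. ln (1 + b \<bullet> f t))"
    using log_integrable_K[OF a] b by (auto simp: log_integrable_def)
  have "AE t in unit_lborel. ln (1 + b \<bullet> f t) - ln (1 + a \<bullet> f t) \<le> ((b - a) \<bullet> f t) / (1 + a \<bullet> f t)"
    using b[unfolded log_integrable_def, THEN conjunct1] AE_space[of unit_lborel]
    by eventually_elim (auto intro: ln_difference_le[OF a])
  then show ?thesis
    using ia ib inner_integral_quotient(2)[OF a]
    by (subst Bochner_Integration.integral_diff[OF ib ia, symmetric]) (intro integral_mono_AE, auto)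
qed

text \<open>At a stationary base point the tangent bound is the inner product of
  \<open>b - a\<close> with \<open>0\<close>; a point \<open>b\<close> that is not log-integrable
  has value \<open>\<infinity>\<close>.\<close>

lemma stationary_imp_minimizer:
  assumes "stationary f a"
  shows "minimizer a"
  unfolding minimizer_def
proof (intro conjI ballI)
  have a: "a \<in> K_set f" and z: "(\<integral>t. f t /\<^sub>R (1 + a \<bullet> f t) \<partial>unit_lborel) = 0"
    using assms by (auto simp: stationary_def)
  show "a \<in> Kbar_set f" using a K_subset_Kbar by blast
  fix b assume "b \<in> Kbar_set f"
  show "g_fun f a \<le> g_fun f b"
  proof (cases "log_integrable b")
    case True
    then show ?thesis
      using integral_ln_difference_le[OF a True] inner_integral_quotient(1)[OF a, of "b - a"] z
      by (simp add: g_fun_eq log_integrable_K[OF a])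
  next
    case False
    then show ?thesis by (simp add: log_integrable_iff)
  qed
qed

section \<open>Inequalities satisfied by the minimizer\<close>

lemma minimizer_value_le_0: "minimizer a \<Longrightarrow> g_fun f a \<le> 0"
  using zero_in_K K_subset_Kbar unfolding minimizer_def g_fun_zero[symmetric] by blast

lemma minimizer_value_less_0:
  assumes m: "minimizer a" and nz: "(\<integral>t. f t \<partial>unit_lborel) \<noteq> 0"
  shows "g_fun f a < 0"
proof (rule ccontr)
  assume "\<not> g_fun f a < 0"
  then have "0 = a"
    using m minimizer_value_le_0[OF m] zero_in_K K_subset_Kbar
    by (intro minimizer_if_le[OF m]) (auto simp: g_fun_zero)
  then have "stationary f 0" using m zero_in_K by (simp add: minimizer_imp_stationary)
  \<comment> \<open>At the origin the integrand in \<open>stationary\<close> is \<open>f t\<close>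
    itself, so its integral is the mean of the path.\<close>
  then show False using nz by (simp add: stationary_def)
qed

lemma minimizer_inner_mean_pos:
  assumes m: "minimizer a" and nz: "(\<integral>t. f t \<partial>unit_lborel) \<noteq> 0"
  shows "0 < a \<bullet> (\<integral>t. f t \<partial>unit_lborel)"
proof -
  note li = minimizer_log_integrable[OF m]
  have "0 < (\<integral>t. ln (1 + a \<bullet> f t) \<partial>unit_lborel)"
    using minimizer_value_less_0[OF m nz] by (simp add: g_fun_eq[OF li])
  also have "\<dots> \<le> a \<bullet> (\<integral>t. f t \<partial>unit_lborel)"
    using integral_ln_difference_le[OF zero_in_K li] integral_inner_path[of a] by simp
  finally show ?thesis .
qed

lemma minimizer_shrunk_integral_nonneg:
  assumes m: "minimizer a" and s: "0 < s" "s < 1"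
  shows "0 \<le> (\<integral>t. (a \<bullet> f t) / (1 + (1 - s) * (a \<bullet> f t)) \<partial>unit_lborel)"
proof -
  let ?b = "(1 - s) *\<^sub>R a"
  have b: "?b \<in> K_set f" using m s by (intro scaleR_Kbar_in_K) (auto simp: minimizer_def)
  note li = minimizer_log_integrable[OF m]
  have "a - ?b = s *\<^sub>R a" by (simp add: algebra_simps)
  then have eq: "((a - ?b) \<bullet> f t) / (1 + ?b \<bullet> f t) = s * ((a \<bullet> f t) / (1 + (1 - s) * (a \<bullet> f t)))" for t
    by (simp only: inner_scaleR_left) simp
  have "g_fun f a \<le> g_fun f ?b" using m b K_subset_Kbar by (auto simp: minimizer_def)
  then have "0 \<le> (\<integral>t. ln (1 + a \<bullet> f t) \<partial>unit_lborel) - (\<integral>t. ln (1 + ?b \<bullet> f t) \<partial>unit_lborel)"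
    unfolding g_fun_eq[OF li] g_fun_eq[OF log_integrable_K[OF b]] by simp
  also have "\<dots> \<le> s * (\<integral>t. (a \<bullet> f t) / (1 + (1 - s) * (a \<bullet> f t)) \<partial>unit_lborel)"
    using integral_ln_difference_le[OF b li] unfolding eq integral_mult_right_zero .
  finally show ?thesis using s(1) by (simp add: zero_le_mult_iff)
qed

text \<open>At each shrunk point the integral is nonnegative, so the negative part is at most the
  positive part. The positive parts converge by domination and the negative parts obey Fatou's
  lemma, so the comparison survives the limit. Finiteness comes from
  \<open>x / (1 + x) \<le> 1\<close> for \<open>1 + x > 0\<close>.\<close>

lemma minimizer_quotient_integral:
  assumes m: "minimizer a"
  shows "0 \<le> ereal_integral unit_lborel (\<lambda>t. ereal (a \<bullet> f t) / ereal (1 + a \<bullet> f t))" (is "0 \<le> ?I")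
    and "ereal_integral unit_lborel (\<lambda>t. ereal (a \<bullet> f t) / ereal (1 + a \<bullet> f t)) < \<infinity>"
proof -
  let ?H = "\<lambda>t. ereal (a \<bullet> f t) / ereal (1 + a \<bullet> f t)"
  let ?h = "\<lambda>t. (a \<bullet> f t) / (1 + a \<bullet> f t)"
  \<comment> \<open>The double \<open>Suc\<close> keeps \<open>s n\<close> strictly below
    \<open>1\<close>.\<close>
  define s where "s = (\<lambda>n. inverse (real (Suc (Suc n))))"
  define r where "r = (\<lambda>n t. (a \<bullet> f t) / (1 + (1 - s n) * (a \<bullet> f t)))"
  have s: "0 < s n" "s n < 1" for n by (auto simp: s_def field_simps)
  have s0: "s \<longlonglongrightarrow> 0" unfolding s_def using LIMSEQ_Suc[OF LIMSEQ_inverse_real_of_nat] by simp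
  have pos: "AE t in unit_lborel. 0 < 1 + a \<bullet> f t"
    using minimizer_log_integrable[OF m] by (simp add: log_integrable_def)
  have den: "0 < 1 + (1 - s n) * (a \<bullet> f t)" if "t \<in> {0..1}" for n t
    using scaleR_Kbar_in_K[of a "1 - s n"] m s[of n] that by (auto simp: minimizer_def K_set_iff)
  have rint: "integrable unit_lborel (r n)" for n
    unfolding r_def using den[of _ n]
    by (intro continuous_on_imp_integrable_unit continuous_intros cont) force
  obtain C where C: "\<And>t. t \<in> {0..1} \<Longrightarrow> norm (f t) \<le> C" using path_bounded by blast
  have p: "(\<integral>\<^sup>+t. e2ennreal (?H t) \<partial>unit_lborel) = (\<integral>\<^sup>+t. ennreal (?h t) \<partial>unit_lborel)"
  proof (rule nn_integral_cong_AE)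
    show "AE t in unit_lborel. e2ennreal (?H t) = ennreal (?h t)"
      using pos by eventually_elim auto
  qed
  have q: "(\<integral>\<^sup>+t. e2ennreal (- ?H t) \<partial>unit_lborel) = (\<integral>\<^sup>+t. ennreal (- ?h t) \<partial>unit_lborel)"
  proof (rule nn_integral_cong_AE)
    show "AE t in unit_lborel. e2ennreal (- ?H t) = ennreal (- ?h t)"
      using pos by eventually_elim auto
  qed
  have "(\<integral>\<^sup>+t. ennreal (?h t) \<partial>unit_lborel) \<le> (\<integral>\<^sup>+t. 1 \<partial>unit_lborel)"
  proof (rule nn_integral_mono_AE)
    show "AE t in unit_lborel. ennreal (?h t) \<le> 1"
      using pos
    proof eventually_elim
      case (elim t)
      then have "?h t \<le> 1" by simp
      then show ?case using ennreal_leI[of "?h t" 1] by simp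
    qed
  qed
  also have "\<dots> = 1" using unit.emeasure_space_1 by simp
  finally have p1: "(\<integral>\<^sup>+t. ennreal (?h t) \<partial>unit_lborel) \<le> 1" .
  have lim: "AE t in unit_lborel. (\<lambda>n. r n t) \<longlonglongrightarrow> ?h t"
    using pos
  proof eventually_elim
    case (elim t)
    have "(\<lambda>n. r n t) \<longlonglongrightarrow> (a \<bullet> f t) / (1 + (1 - 0) * (a \<bullet> f t))"
      unfolding r_def using elim by (intro tendsto_intros s0) auto
    then show ?case by simp
  qed
  have plim: "(\<lambda>n. \<integral>\<^sup>+t. ennreal (r n t) \<partial>unit_lborel) \<longlonglongrightarrow> (\<integral>\<^sup>+t. ennreal (?h t) \<partial>unit_lborel)"
  proof (rule nn_integral_dominated_convergence)
    show "AE t in unit_lborel. ennreal (r n t) \<le> ennreal (norm a * C)" for n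
    proof (rule AE_I2, intro ennreal_leI)
      fix t assume "t \<in> space unit_lborel"
      then have t: "t \<in> {0..1}" by simp
      have x: "a \<bullet> f t \<le> norm a * C"
        using C[OF t] by (intro order_trans[OF norm_cauchy_schwarz] mult_left_mono) auto
      have C0: "0 \<le> norm a * C" using order_trans[OF norm_ge_zero C[OF t]] by simp
      show "r n t \<le> norm a * C"
      proof (cases "0 \<le> a \<bullet> f t")
        case True
        then have "r n t \<le> a \<bullet> f t / 1"
          unfolding r_def using s[of n] den[OF t, of n] by (intro divide_left_mono) auto
        with x show ?thesis by simp
      next
        case False
        then have "r n t \<le> 0" unfolding r_def using den[OF t, of n] by (simp add: divide_nonpos_pos)
        with C0 show ?thesis by simp
      qed
    qed
    show "(\<integral>\<^sup>+t. ennreal (norm a * C) \<partial>unit_lborel) < \<infinity>"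
      using unit.emeasure_space_1 by simp
    show "AE t in unit_lborel. (\<lambda>n. ennreal (r n t)) \<longlonglongrightarrow> ennreal (?h t)"
      using lim by eventually_elim (rule tendsto_ennrealI)
    show "(\<lambda>t. ennreal (r n t)) \<in> borel_measurable unit_lborel" for n
      unfolding r_def by measurable
  qed measurable
  have le: "(\<integral>\<^sup>+t. ennreal (- r n t) \<partial>unit_lborel) \<le> (\<integral>\<^sup>+t. ennreal (r n t) \<partial>unit_lborel)" for n
  proof -
    have fin: "(\<integral>\<^sup>+t. ennreal (r n t) \<partial>unit_lborel) \<noteq> \<infinity>" "(\<integral>\<^sup>+t. ennreal (- r n t) \<partial>unit_lborel) \<noteq> \<infinity>"
      using rint[of n] by (auto simp: real_integrable_def)
    have "0 \<le> integral\<^sup>L unit_lborel (r n)"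
      unfolding r_def by (rule minimizer_shrunk_integral_nonneg[OF m s])
    then have "enn2real (\<integral>\<^sup>+t. ennreal (- r n t) \<partial>unit_lborel) \<le> enn2real (\<integral>\<^sup>+t. ennreal (r n t) \<partial>unit_lborel)"
      unfolding real_lebesgue_integral_def[OF rint] by simp
    then show ?thesis using fin
      by (metis ennreal_enn2real ennreal_leI infinity_ennreal_def top.not_eq_extremum)
  qed
  have "(\<integral>\<^sup>+t. ennreal (- ?h t) \<partial>unit_lborel) = (\<integral>\<^sup>+t. liminf (\<lambda>n. ennreal (- r n t)) \<partial>unit_lborel)"
  proof (rule nn_integral_cong_AE)
    show "AE t in unit_lborel. ennreal (- ?h t) = liminf (\<lambda>n. ennreal (- r n t))"
      using lim by eventually_elim
        (intro lim_imp_Liminf[symmetric] tendsto_ennrealI tendsto_minus, auto)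
  qed
  also have "\<dots> \<le> liminf (\<lambda>n. \<integral>\<^sup>+t. ennreal (- r n t) \<partial>unit_lborel)"
    by (rule nn_integral_liminf) (simp add: r_def)
  also have "\<dots> \<le> liminf (\<lambda>n. \<integral>\<^sup>+t. ennreal (r n t) \<partial>unit_lborel)"
    using le by (intro Liminf_mono) auto
  also have "\<dots> = (\<integral>\<^sup>+t. ennreal (?h t) \<partial>unit_lborel)"
    using plim by (intro lim_imp_Liminf) auto
  finally have qp: "(\<integral>\<^sup>+t. ennreal (- ?h t) \<partial>unit_lborel) \<le> (\<integral>\<^sup>+t. ennreal (?h t) \<partial>unit_lborel)" .
  define P where "P = (\<integral>\<^sup>+t. ennreal (?h t) \<partial>unit_lborel)"
  define Q where "Q = (\<integral>\<^sup>+t. ennreal (- ?h t) \<partial>unit_lborel)"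
  have I: "?I = enn2ereal P - enn2ereal Q" unfolding ereal_integral_def p q P_def Q_def ..
  have PQ: "enn2ereal P \<le> 1" "enn2ereal Q \<le> enn2ereal P" "0 \<le> enn2ereal Q"
    using p1 qp by (auto simp: P_def Q_def less_eq_ennreal.rep_eq one_ennreal.rep_eq)
  show "0 \<le> ?I" "?I < \<infinity>"
    unfolding I using PQ by (cases "enn2ereal P"; cases "enn2ereal Q"; simp)+
qed

text \<open>A dense sequence may miss the minimizer and the boundary altogether. Nearly optimal
  points nevertheless form a nonempty open subset of \<open>K_set f\<close>, because the value at
  \<open>(1 - d) *\<^sub>R a\<close> is at most \<open>1 - d\<close> times the value at
  \<open>a\<close>.\<close>

lemma near_minimizer_open:
  assumes m: "minimizer a" and e: "0 < e"
  shows "open {b \<in> K_set f. ereal (g_real b) < g_fun f a + ereal e}" (is "open ?U")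
    and "{b \<in> K_set f. ereal (g_real b) < g_fun f a + ereal e} \<noteq> {}"
proof -
  note li = minimizer_log_integrable[OF m]
  define L where "L = - (\<integral>t. ln (1 + a \<bullet> f t) \<partial>unit_lborel)"
  have L: "g_fun f a = ereal L" unfolding L_def by (rule g_fun_eq[OF li])
  have U: "?U = K_set f \<inter> g_real -` {..<L + e}" by (auto simp: L)
  have "continuous_on (K_set f) g_real"
    by (auto intro!: continuous_at_imp_continuous_on has_derivative_continuous[OF g_real_has_derivative])
  then show "open ?U"
    unfolding U by (intro continuous_open_preimage open_K) auto
  show "?U \<noteq> {}"
  \<comment> \<open>The strict concavity lemma is applied to \<open>0\<close> and \<open>a\<close>,
    which therefore have to be distinct.\<close>
  proof (cases "a = 0")
    case True
    then have "g_real a = L" using g_fun_K[OF zero_in_K] L by simp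
    then have "0 \<in> ?U" using True zero_in_K e unfolding U by simp
    then show ?thesis by blast
  next
    case False
    have L0: "L \<le> 0" using minimizer_value_le_0[OF m] L by simp
    \<comment> \<open>Shrinking by \<open>d\<close> costs at most \<open>d * - L\<close>, which is
      below \<open>e\<close> since \<open>- L / (1 - L) < 1\<close>; the bound \<open>1/2\<close>
      ensures \<open>d < 1\<close>.\<close>
    define d where "d = min e (1/2) / (1 - L)"
    have d: "0 < d" "d < 1" "d * - L < e"
    proof -
      show "0 < d" using L0 e by (auto simp: d_def)
      have "d \<le> (1/2) / 1" unfolding d_def using L0 by (intro frac_le) auto
      then show "d < 1" by simp
      have "d * - L \<le> e * - L / (1 - L)" unfolding d_def using L0 by (simp add: divide_right_mono mult_right_mono_neg)
      also have "\<dots> < e" using L0 e by (simp add: field_simps)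
      finally show "d * - L < e" .
    qed
    have b: "(1 - d) *\<^sub>R a \<in> K_set f"
      using m d by (intro scaleR_Kbar_in_K) (auto simp: minimizer_def)
    have "(1 - d) * - L < (\<integral>t. ln (1 + ((1 - d) *\<^sub>R a) \<bullet> f t) \<partial>unit_lborel)"
      using integral_ln_convex_comb_less[OF log_integrable_K[OF zero_in_K] li, of "1 - d"] False d
      by (simp add: L_def)
    moreover have "g_real ((1 - d) *\<^sub>R a) = - (\<integral>t. ln (1 + ((1 - d) *\<^sub>R a) \<bullet> f t) \<partial>unit_lborel)"
      using g_fun_K[OF b] g_fun_eq[OF log_integrable_K[OF b]] by simp
    ultimately have "g_real ((1 - d) *\<^sub>R a) < L + e" using d(3) by (simp add: algebra_simps)
    then have "(1 - d) *\<^sub>R a \<in> ?U" using b unfolding U by simp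
    then show ?thesis by blast
  qed
qed

text \<open>Some \<open>q k\<close> lies in the set of \<open>near_minimizer_open\<close>, and from
  then on the recorded value is within \<open>e\<close> of the minimum. The iterates thus form a
  minimizing sequence.\<close>

lemma greedy_LIMSEQ:
  assumes m: "minimizer a"
    and dense: "\<And>X. open X \<Longrightarrow> X \<noteq> {} \<Longrightarrow> \<exists>n. q n \<in> X"
    and P: "\<And>n. P n \<longleftrightarrow> q n \<in> K_set f"
    and h: "\<And>n. q n \<in> K_set f \<Longrightarrow> h n = g_real (q n)"
  shows "(\<lambda>n. fst (greedy P h q n)) \<longlonglongrightarrow> a"
proof -
  let ?G = "greedy P h q"
  have inv: "fst (?G n) \<in> K_set f \<and> snd (?G n) = g_real (fst (?G n))" for n
    using zero_in_K P h g_fun_K[OF zero_in_K] g_fun_zero by (induction n) auto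
  have dec: "snd (?G n) \<le> h k" if "k < n" "P k" for n k
    using that by (induction n) (auto simp: less_Suc_eq)
  have ge: "g_fun f a \<le> g_fun f (fst (?G n))" for n
    using m inv[of n] K_subset_Kbar by (auto simp: minimizer_def)
  obtain L where L: "g_fun f a = ereal L"
    using g_fun_eq[OF minimizer_log_integrable[OF m]] by blast
  have "(\<lambda>n. snd (?G n)) \<longlonglongrightarrow> L"
  proof (rule LIMSEQ_I)
    fix e :: real assume e: "0 < e"
    obtain k where k: "q k \<in> K_set f" "g_real (q k) < L + e"
      using dense[OF near_minimizer_open[OF m e]] L by auto
    have "norm (snd (?G n) - L) < e" if "Suc k \<le> n" for n
    proof -
      have "snd (?G n) \<le> g_real (q k)" using dec[of k n] that k P h by auto
      moreover have "L \<le> snd (?G n)" using ge[of n] inv[of n] by (simp add: L g_fun_K)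
      ultimately show ?thesis using k(2) by simp
    qed
    then show "\<exists>no. \<forall>n\<ge>no. norm (snd (?G n) - L) < e" by blast
  qed
  then have "(\<lambda>n. g_fun f (fst (?G n))) \<longlonglongrightarrow> g_fun f a"
    using inv by (simp add: L g_fun_K)
  then show ?thesis
    using inv K_subset_Kbar by (intro minimizing_sequence_LIMSEQ[OF m]) auto
qed

end

section \<open>Weighted integrals of Brownian motion\<close>

lemma normal_density_le:
  assumes "0 < s" "s \<le> \<sigma>"
  shows "normal_density \<mu> \<sigma> x \<le> 1 / s"
proof -
  have "s\<^sup>2 \<le> \<sigma>\<^sup>2" using assms by (intro power_mono) auto
  also have "\<dots> = 1 * \<sigma>\<^sup>2" by simp
  also have "\<dots> \<le> 2 * pi * \<sigma>\<^sup>2" using pi_ge_two by (intro mult_right_mono) auto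
  finally have "s \<le> sqrt (2 * pi * \<sigma>\<^sup>2)" by (rule real_le_rsqrt)
  then have "1 / sqrt (2 * pi * \<sigma>\<^sup>2) \<le> 1 / s" using assms by (intro divide_left_mono) auto
  moreover have "1 / sqrt (2 * pi * \<sigma>\<^sup>2) * exp (- (x - \<mu>)\<^sup>2 / (2 * \<sigma>\<^sup>2)) \<le> 1 / sqrt (2 * pi * \<sigma>\<^sup>2) * 1"
    using assms by (intro mult_left_mono) auto
  ultimately show ?thesis unfolding normal_density_def by linarith
qed

text \<open>The bound is uniform over all standard deviations at least \<open>s\<close>, so along
  the Riemann sums only a lower bound on the variance is required.\<close>

lemma normal_small_ball:
  assumes "distributed M lborel X (normal_density \<mu> \<sigma>)" "0 < s" "s \<le> \<sigma>" "0 < e"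
  shows "emeasure M {\<omega>\<in>space M. \<bar>X \<omega>\<bar> < e} \<le> ennreal (2 * e / s)"
proof -
  have "{\<omega>\<in>space M. \<bar>X \<omega>\<bar> < e} = X -` {-e<..<e} \<inter> space M" by auto
  also have "emeasure M \<dots> = (\<integral>\<^sup>+x. ennreal (normal_density \<mu> \<sigma> x) * indicator {-e<..<e} x \<partial>lborel)"
    by (rule distributed_emeasure[OF assms(1)]) auto
  also have "\<dots> \<le> (\<integral>\<^sup>+x. ennreal (1 / s) * indicator {-e<..<e} x \<partial>lborel)"
    using assms by (intro nn_integral_mono mult_right_mono ennreal_leI normal_density_le) auto
  also have "\<dots> = ennreal (1 / s) * ennreal (2 * e)"
    using assms by (simp add: nn_integral_cmult_indicator)
  also have "\<dots> = ennreal (2 * e / s)" using assms by (simp flip: ennreal_mult)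
  finally show ?thesis .
qed

text \<open>If the limit is \<open>0\<close>, then \<open>\<bar>S n\<bar> < e\<close> from some
  index on. These events increase with the index, and each lies in a small-ball event of probability
  at most \<open>C * e\<close>, so the union obeys the same bound.\<close>

lemma (in prob_space) AE_limit_ne_0:
  fixes S :: "nat \<Rightarrow> 'a \<Rightarrow> real"
  assumes [measurable]: "\<And>n. S n \<in> borel_measurable M"
    and lim: "AE \<omega> in M. (\<lambda>n. S n \<omega>) \<longlonglongrightarrow> L \<omega>"
    and small: "\<And>e. 0 < e \<Longrightarrow> \<forall>\<^sub>F n in sequentially. emeasure M {\<omega>\<in>space M. \<bar>S n \<omega>\<bar> < e} \<le> ennreal (C * e)"
  shows "AE \<omega> in M. L \<omega> \<noteq> 0"
proof -
  \<comment> \<open>Expressed through the sequence, because measurability is known for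
    \<open>S n\<close> only, not for \<open>L\<close>.\<close>
  define Z where "Z = {\<omega>\<in>space M. (\<lambda>n. S n \<omega>) \<longlonglongrightarrow> 0}"
  have Z: "Z \<in> sets M" unfolding Z_def by measurable
  have "emeasure M Z \<le> ennreal (C * e)" if e: "0 < e" for e
  proof -
    define E where "E = (\<lambda>N. {\<omega>\<in>space M. \<forall>n\<ge>N. \<bar>S n \<omega>\<bar> < e})"
    have Em: "E N \<in> sets M" for N unfolding E_def by measurable
    have "incseq E" by (auto simp: incseq_def E_def)
    have EN: "emeasure M (E N) \<le> ennreal (C * e)" for N
    proof -
      obtain n where n: "N \<le> n" "emeasure M {\<omega>\<in>space M. \<bar>S n \<omega>\<bar> < e} \<le> ennreal (C * e)"
        using small[OF e] unfolding eventually_sequentially by (meson nle_le)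
      have "emeasure M (E N) \<le> emeasure M {\<omega>\<in>space M. \<bar>S n \<omega>\<bar> < e}"
        using n(1) by (intro emeasure_mono) (auto simp: E_def)
      with n(2) show ?thesis by simp
    qed
    have "Z \<subseteq> (\<Union>N. E N)"
    proof
      fix \<omega> assume "\<omega> \<in> Z"
      then have "\<omega> \<in> space M" "(\<lambda>n. S n \<omega>) \<longlonglongrightarrow> 0" by (auto simp: Z_def)
      with tendstoD[OF this(2) e] have "\<omega> \<in> space M" "\<forall>\<^sub>F n in sequentially. dist (S n \<omega>) 0 < e"
        by auto
      then show "\<omega> \<in> (\<Union>N. E N)" by (auto simp: E_def eventually_sequentially)
    qed
    then have "emeasure M Z \<le> emeasure M (\<Union>N. E N)" using Em by (intro emeasure_mono) auto
    also have "\<dots> = (SUP N. emeasure M (E N))"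
      using Em \<open>incseq E\<close> by (intro SUP_emeasure_incseq[symmetric]) auto
    also have "\<dots> \<le> ennreal (C * e)" using EN by (intro SUP_least)
    finally show ?thesis .
  qed
  then have *: "emeasure M Z \<le> ennreal (C * inverse (real (Suc n)))" for n by simp
  have "(\<lambda>n. ennreal (C * inverse (real (Suc n)))) \<longlonglongrightarrow> ennreal (C * 0)"
    by (intro tendsto_ennrealI tendsto_intros LIMSEQ_inverse_real_of_nat)
  from LIMSEQ_le_const[OF this] * have "emeasure M Z \<le> 0" by auto
  then have "Z \<in> null_sets M" using Z by auto
  from AE_not_in[OF this] lim AE_space show ?thesis
    by eventually_elim (auto simp: Z_def)
qed

lemma sum_below_swap:
  fixes a :: "nat \<Rightarrow> nat \<Rightarrow> real"
  shows "(\<Sum>i<n. \<Sum>j<i. a i j) = (\<Sum>j<n. \<Sum>i\<in>{j<..<n}. a i j)"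
proof (induction n)
  case (Suc n)
  have "{j<..<Suc n} = insert n {j<..<n}" if "j < n" for j using that by auto
  then have "(\<Sum>j<n. \<Sum>i\<in>{j<..<Suc n}. a i j) = (\<Sum>j<n. a n j + (\<Sum>i\<in>{j<..<n}. a i j))"
    by (intro sum.cong) auto
  moreover have "{n<..<Suc n} = {}" by auto
  ultimately show ?case using Suc by (simp add: sum.distrib)
qed simp

lemma integral_unit_pos:
  fixes h :: "real \<Rightarrow> real"
  assumes c: "continuous_on {0..1} h" and nn: "\<And>t. t \<in> {0..1} \<Longrightarrow> 0 \<le> h t"
    and t: "t \<in> {0..1}" "0 < h t"
  shows "0 < integral {0..1} h"
proof -
  have "0 \<le> integral {0..1} h" using nn by (intro integral_nonneg integrable_continuous_real c) auto
  moreover have "integral {0..1} h \<noteq> 0"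
  proof
    assume "integral {0..1} h = 0"
    then have "(h has_integral 0) (cbox 0 1)"
      using integrable_continuous_real[OF c] by (simp add: has_integral_integral)
    then have "h t = 0" using c nn t by (intro has_integral_0_cbox_imp_0[of 0 1 h]) auto
    then show False using t by simp
  qed
  ultimately show ?thesis by simp
qed

lemma (in prob_space) std_brownian_motion_uniform_increments:
  assumes "std_brownian_motion M W"
  shows "indep_vars (\<lambda>_. borel) (\<lambda>k \<omega>. W (real (Suc k) / n) \<omega> - W (real k / n) \<omega>) {..<n}"
proof -
  \<comment> \<open>The independence clause wants an infinite monotone sequence of times in
    \<open>{0..1}\<close>; the truncation leaves the first \<open>n\<close> increments
    unchanged.\<close>
  let ?t = "\<lambda>k. min (real k / n) 1"
  have "mono ?t" by (intro monoI min.mono divide_right_mono) auto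
  moreover have "range ?t \<subseteq> {0..1}" by auto
  ultimately have *: "indep_vars (\<lambda>_. borel) (\<lambda>k \<omega>. W (?t (Suc k)) \<omega> - W (?t k) \<omega>) {..<n}"
    using assms unfolding std_brownian_motion_def by blast
  have t: "?t k = real k / n" if "k \<le> n" for k
    using that by (cases "n = 0") (auto simp: min_def field_simps)
  have eq: "(\<lambda>\<omega>. W (?t (Suc k)) \<omega> - W (?t k) \<omega>) = (\<lambda>\<omega>. W (real (Suc k) / n) \<omega> - W (real k / n) \<omega>)"
    if "k \<in> {..<n}" for k
    using t[of k] t[of "Suc k"] that by (simp only: lessThan_iff Suc_le_eq less_imp_le)
  from indep_vars_cong[OF refl eq refl, THEN iffD1, OF _ *] show ?thesis .
qed

context prob_space
begin

context
  fixes W :: "real \<Rightarrow> 'a \<Rightarrow> real" and w :: "real \<Rightarrow> real" and c :: real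
  assumes bm: "std_brownian_motion M W"
    and w: "continuous_on {0..1} w" "\<And>t. t \<in> {0..1} \<Longrightarrow> 0 \<le> w t"
    and c: "0 < c" "c \<le> 1" "\<And>t. t \<in> {0<..<c} \<Longrightarrow> 0 < w t"
begin

text \<open>Riemann sum of \<open>w\<close> beyond the grid point \<open>j / n\<close>. It is the
  coefficient of the \<open>j\<close>-th increment after summation by parts; the index
  \<open>j\<close> itself is excluded because \<open>W (j / n)\<close> contains only the increments
  before it.\<close>

definition tail_weight :: "nat \<Rightarrow> nat \<Rightarrow> real" where
  "tail_weight n j = (\<Sum>i\<in>{j<..<n}. w (real i / n)) / n"

definition weighted_sum :: "nat \<Rightarrow> 'a \<Rightarrow> real" where
  "weighted_sum n \<omega> = (\<Sum>j<n. tail_weight n j * (W (real (Suc j) / n) \<omega> - W (real j / n) \<omega>))"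

lemma W_measurable: "t \<in> {0..1} \<Longrightarrow> W t \<in> borel_measurable M"
  using bm by (simp add: std_brownian_motion_def)

lemma grid_in_unit: "k \<le> n \<Longrightarrow> real k / real n \<in> {0..1}"
  by (cases "n = 0") (auto simp: field_simps)

lemma weighted_sum_measurable: "weighted_sum n \<in> borel_measurable M"
  unfolding weighted_sum_def
  by (intro borel_measurable_sum borel_measurable_times borel_measurable_diff W_measurable grid_in_unit) auto

lemma weighted_sum_eq_Riemann_sum:
  assumes "W 0 \<omega> = 0"
  shows "weighted_sum n \<omega> = (\<Sum>k<n. w (real k / n) * W (real k / n) \<omega>) / n"
proof -
  let ?d = "\<lambda>j. W (real (Suc j) / n) \<omega> - W (real j / n) \<omega>"
  have tel: "W (real k / n) \<omega> = (\<Sum>j<k. ?d j)" for k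
    using sum_lessThan_telescope[of "\<lambda>k. W (real k / n) \<omega>" k] assms by simp
  have "(\<Sum>k<n. w (real k / n) * W (real k / n) \<omega>) = (\<Sum>k<n. \<Sum>j<k. w (real k / n) * ?d j)"
    unfolding sum_distrib_left[symmetric] by (intro sum.cong refl arg_cong[OF tel])
  also have "\<dots> = (\<Sum>j<n. \<Sum>k\<in>{j<..<n}. w (real k / n) * ?d j)" by (rule sum_below_swap)
  finally show ?thesis
    by (simp add: weighted_sum_def tail_weight_def sum_distrib_right sum_divide_distrib)
qed

lemma weighted_sum_distributed:
  assumes "0 < (\<Sum>j<n. (tail_weight n j)\<^sup>2 / n)"
  shows "distributed M lborel (weighted_sum n)
    (normal_density 0 (sqrt (\<Sum>j<n. (tail_weight n j)\<^sup>2 / n)))"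
proof -
  \<comment> \<open>A term with weight \<open>0\<close> is a point mass and has no normal density,
    so it is dropped from the sum.\<close>
  define I where "I = {j\<in>{..<n}. tail_weight n j \<noteq> 0}"
  have n: "n \<noteq> 0" using assms by (cases n) auto
  let ?D = "\<lambda>j \<omega>. W (real (Suc j) / n) \<omega> - W (real j / n) \<omega>"
  let ?X = "\<lambda>j \<omega>. tail_weight n j * ?D j \<omega>"
  have "indep_vars (\<lambda>_. borel) ?D I"
    by (rule indep_vars_subset[OF std_brownian_motion_uniform_increments[OF bm]]) (auto simp: I_def)
  then have ind: "indep_vars (\<lambda>_. borel) ?X I"
    by (rule indep_vars_compose2) measurable
  have D: "distributed M lborel (?X j) (normal_density 0 (\<bar>tail_weight n j\<bar> * sqrt (1 / n)))" if "j \<in> I" for j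
  proof -
    have "real (Suc j) / n - real j / n = 1 / n" using n by (simp add: field_simps)
    moreover have "distributed M lborel (?D j) (normal_density 0 (sqrt (real (Suc j) / n - real j / n)))"
      using bm that grid_in_unit[of "Suc j" n] n unfolding std_brownian_motion_def I_def
      by (auto simp: divide_strict_right_mono)
    ultimately have "distributed M lborel (?D j) (normal_density 0 (sqrt (1 / n)))" by simp
    from normal_density_affine[OF this, of "tail_weight n j" 0] show ?thesis
      using that n by (simp add: I_def)
  qed
  have sums: "(\<Sum>j\<in>I. (\<bar>tail_weight n j\<bar> * sqrt (1 / n))\<^sup>2) = (\<Sum>j<n. (tail_weight n j)\<^sup>2 / n)"
    unfolding I_def by (intro sum.mono_neutral_cong_left) (auto simp: power_mult_distrib)
  have "I \<noteq> {}" using assms sums by auto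
  then have "distributed M lborel (\<lambda>x. \<Sum>i\<in>I. ?X i x)
      (normal_density (\<Sum>i\<in>I. 0) (sqrt (\<Sum>i\<in>I. (\<bar>tail_weight n i\<bar> * sqrt (1 / n))\<^sup>2)))"
    using n by (intro sum_indep_normal ind D) (auto simp: I_def)
  moreover have "(\<lambda>x. \<Sum>i\<in>I. ?X i x) = weighted_sum n"
    unfolding I_def weighted_sum_def by (intro ext sum.mono_neutral_cong_left) auto
  ultimately show ?thesis unfolding sums by simp
qed

text \<open>For grid times up to \<open>c / 2\<close> the tail weight is at least the mass of
  \<open>w\<close> beyond \<open>c / 2\<close>, which is positive since \<open>w > 0\<close> on the
  interval from \<open>0\<close> to \<open>c\<close>. This decouples the double sum into a product
  of two ordinary Riemann sums.\<close>

lemma variance_bounded_below: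
  "\<exists>v>0. \<forall>\<^sub>F n in sequentially. v \<le> (\<Sum>j<n. (tail_weight n j)\<^sup>2 / n)"
proof -
  \<comment> \<open>\<open>h\<close> and \<open>k\<close> are continuous substitutes for
    \<open>w\<close> restricted to times after \<open>c / 2\<close> and for the indicator of times
    before it, so that \<open>Riemann_sum_LIMSEQ\<close> applies; on the unit interval
    \<open>h \<le> w\<close> and \<open>k \<le> 1\<close>.\<close>
  define h where "h = (\<lambda>t. w t * max 0 (t - c / 2))"
  define k where "k = (\<lambda>t::real. max 0 (c / 2 - t))"
  have hc: "continuous_on {0..1} h" and kc: "continuous_on {0..1} k"
    unfolding h_def k_def by (intro continuous_intros w)+
  define b where "b = (\<lambda>n. (\<Sum>i<n. h (real i / real n)) / real n)"
  define a where "a = (\<lambda>n. (\<Sum>i<n. k (real i / real n)) / real n)"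
  have hpos: "0 < integral {0..1} h"
    by (rule integral_unit_pos[OF hc, of "3 * c / 4"]) (use c w in \<open>auto simp: h_def\<close>)
  have kpos: "0 < integral {0..1} k"
    by (rule integral_unit_pos[OF kc, of 0]) (use c in \<open>auto simp: k_def\<close>)
  have "b \<longlonglongrightarrow> integral {0..1} h" "a \<longlonglongrightarrow> integral {0..1} k"
    unfolding a_def b_def by (intro Riemann_sum_LIMSEQ hc kc)+
  then have lim: "(\<lambda>n. (b n)\<^sup>2 * a n) \<longlonglongrightarrow> (integral {0..1} h)\<^sup>2 * integral {0..1} k"
    by (intro tendsto_intros)
  define v where "v = (integral {0..1} h)\<^sup>2 * integral {0..1} k / 2"
  have v: "0 < v" "v < (integral {0..1} h)\<^sup>2 * integral {0..1} k" using hpos kpos by (auto simp: v_def)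
  have le: "(b n)\<^sup>2 * a n \<le> (\<Sum>j<n. (tail_weight n j)\<^sup>2 / n)" for n
  proof -
    have hnn: "0 \<le> h (real i / n)" if "i < n" for i
      using w(2)[OF grid_in_unit[of i n]] that by (simp add: h_def)
    have b0: "0 \<le> b n" unfolding b_def using hnn by (auto intro!: divide_nonneg_nonneg sum_nonneg)
    have "(b n)\<^sup>2 * k (real j / n) \<le> (tail_weight n j)\<^sup>2" if j: "j < n" for j
    proof (cases "real j / n \<le> c / 2")
      case True
      have "h (real i / n) = 0" if "i \<le> j" for i
      proof -
        have "real i / n \<le> real j / n" using that by (intro divide_right_mono) auto
        then have "max 0 (real i / n - c / 2) = 0" using True by (intro max_absorb1) linarith
        then show ?thesis by (simp add: h_def)
      qed
      then have "(\<Sum>i<n. h (real i / n)) = (\<Sum>i\<in>{j<..<n}. h (real i / n))"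
        by (intro sum.mono_neutral_right) auto
      also have "\<dots> \<le> (\<Sum>i\<in>{j<..<n}. w (real i / n))"
      proof (rule sum_mono)
        fix i assume "i \<in> {j<..<n}"
        then have i: "real i / n \<in> {0..1}" by (intro grid_in_unit) auto
        then have "w (real i / n) * max 0 (real i / n - c / 2) \<le> w (real i / n) * 1"
          using w(2)[OF i] c by (intro mult_left_mono) auto
        then show "h (real i / n) \<le> w (real i / n)" by (simp add: h_def)
      qed
      finally have "b n \<le> tail_weight n j"
        unfolding b_def tail_weight_def by (intro divide_right_mono) auto
      then have le: "(b n)\<^sup>2 \<le> (tail_weight n j)\<^sup>2" using b0 by (intro power_mono)
      have "0 \<le> real j / n" by simp
      then have "k (real j / n) \<le> 1" using c(2) unfolding k_def by linarith
      then have "(b n)\<^sup>2 * k (real j / n) \<le> (b n)\<^sup>2 * 1" by (intro mult_left_mono) auto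
      with le show ?thesis by simp
    next
      case False
      then show ?thesis by (simp add: k_def)
    qed
    then have "(\<Sum>j<n. (b n)\<^sup>2 * k (real j / n) / n) \<le> (\<Sum>j<n. (tail_weight n j)\<^sup>2 / n)"
      by (intro sum_mono divide_right_mono) auto
    then show ?thesis unfolding a_def by (simp add: sum_distrib_left sum_divide_distrib)
  qed
  show ?thesis
    using v order_tendstoD(1)[OF lim v(2)]
    by (intro exI[of _ v] conjI) (auto elim!: eventually_mono intro: order_trans[OF _ le])
qed

lemma AE_weighted_integral_ne_0: "AE \<omega> in M. integral {0..1} (\<lambda>t. w t * W t \<omega>) \<noteq> 0"
proof -
  obtain v where v: "0 < v" "\<forall>\<^sub>F n in sequentially. v \<le> (\<Sum>j<n. (tail_weight n j)\<^sup>2 / n)"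
    using variance_bounded_below by blast
  show ?thesis
  proof (rule AE_limit_ne_0[OF weighted_sum_measurable])
    have "AE \<omega> in M. W 0 \<omega> = 0" "AE \<omega> in M. continuous_on {0..1} (\<lambda>t. W t \<omega>)"
      using bm by (auto simp: std_brownian_motion_def)
    then show "AE \<omega> in M. (\<lambda>n. weighted_sum n \<omega>) \<longlonglongrightarrow> integral {0..1} (\<lambda>t. w t * W t \<omega>)"
    proof eventually_elim
      case (elim \<omega>)
      show ?case
        unfolding weighted_sum_eq_Riemann_sum[OF elim(1)]
        by (rule Riemann_sum_LIMSEQ) (intro continuous_intros w elim)
    qed
    fix e :: real assume e: "0 < e"
    show "\<forall>\<^sub>F n in sequentially. emeasure M {\<omega>\<in>space M. \<bar>weighted_sum n \<omega>\<bar> < e} \<le> ennreal ((2 / sqrt v) * e)"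
      using v(2)
    proof eventually_elim
      case (elim n)
      then have "0 < (\<Sum>j<n. (tail_weight n j)\<^sup>2 / n)" using v(1) by linarith
      from normal_small_ball[OF weighted_sum_distributed[OF this], of "sqrt v" e] show ?case
        using elim v(1) e by simp
    qed
  qed
qed

end

end

section \<open>Brownian motion visits every orthant\<close>

lemma std_brownian_motion_increment:
  assumes "std_brownian_motion M W" "0 \<le> s" "s < t" "t \<le> 1"
  shows "distributed M lborel (\<lambda>\<omega>. W t \<omega> - W s \<omega>) (normal_density 0 (sqrt (t - s)))"
  using assms unfolding std_brownian_motion_def by blast

text \<open>Taking the standard deviation as threshold makes the probability one constant for all
  scales and both signs.\<close>

lemma (in prob_space) normal_tail_prob:
  assumes D: "distributed M lborel X (normal_density 0 \<sigma>)" and "0 < \<sigma>" and s: "\<bar>s\<bar> = 1"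
  shows "prob {\<omega>\<in>space M. \<sigma> < s * X \<omega>} = measure (density lborel std_normal_density) {1<..}"
proof -
  have "\<bar>s / \<sigma>\<bar> * \<sigma> = 1" using assms by (simp add: abs_divide)
  moreover have "distributed M lborel (\<lambda>\<omega>. 0 + (s / \<sigma>) * X \<omega>) (normal_density (0 + (s / \<sigma>) * 0) (\<bar>s / \<sigma>\<bar> * \<sigma>))"
    using assms by (intro normal_density_affine) auto
  ultimately have Z: "distributed M lborel (\<lambda>\<omega>. (s / \<sigma>) * X \<omega>) std_normal_density"
    by (simp only: add_0 mult_zero_right)
  have "{\<omega>\<in>space M. \<sigma> < s * X \<omega>} = (\<lambda>\<omega>. (s / \<sigma>) * X \<omega>) -` {1<..} \<inter> space M"
    using assms(2) by (auto simp: field_simps)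
  then have "emeasure M {\<omega>\<in>space M. \<sigma> < s * X \<omega>} =
      (\<integral>\<^sup>+x. ennreal (std_normal_density x) * indicator {1<..} x \<partial>lborel)"
    using distributed_emeasure[OF Z, of "{1<..}"] by simp
  also have "\<dots> = emeasure (density lborel std_normal_density) {1<..}"
    by (simp add: emeasure_density)
  finally show ?thesis by (simp add: measure_def)
qed

lemma std_normal_tail_pos: "0 < measure (density lborel std_normal_density) {1<..}"
proof -
  interpret N: prob_space "density lborel std_normal_density" by (rule prob_space_normal_density) simp
  have "emeasure (density lborel std_normal_density) {1<..} \<noteq> 0"
  proof
    assume "emeasure (density lborel std_normal_density) {1<..} = 0"
    then have "{1<..} \<in> null_sets (density lborel std_normal_density)" by auto
    then have "AE x in lborel. x \<in> {1<..} \<longrightarrow> ennreal (std_normal_density x) = 0"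
      by (subst (asm) null_sets_density_iff) auto
    then have "AE x in lborel. x \<notin> {1<..<2::real}"
    proof eventually_elim
      case (elim x)
      then show ?case using normal_density_pos[of 1 0 x] by (auto simp: ennreal_eq_0_iff)
    qed
    then have "{1<..<2::real} \<in> null_sets lborel" by (subst AE_iff_null_sets) auto
    then show False by auto
  qed
  then show ?thesis by (simp add: N.emeasure_eq_measure zero_less_measure_iff)
qed

text \<open>Rapid decay makes the increment over $[t_{n+1},t_n]$ dominate the value at $t_{n+1}$.\<close>

definition fast_time :: "real \<Rightarrow> nat \<Rightarrow> real" where
  "fast_time c n = c / 2 ^ (n\<^sup>2 + 1)"

lemma fast_time_Suc: "fast_time c n = 2 ^ (2 * n + 1) * fast_time c (Suc n)"
proof -
  have "(Suc n)\<^sup>2 + 1 = (2 * n + 1) + (n\<^sup>2 + 1)" by (simp add: power2_eq_square)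
  then show ?thesis unfolding fast_time_def by (simp only: power_add) simp
qed

lemma fast_time_bounds:
  assumes "0 < c"
  shows "0 < fast_time c n" "fast_time c n < c" "fast_time c (Suc n) < fast_time c n"
proof -
  show pos: "0 < fast_time c n" for n using assms by (simp add: fast_time_def)
  have "c * 1 < c * 2 ^ (n\<^sup>2 + 1)" using assms by (intro mult_strict_left_mono one_less_power) auto
  then show "fast_time c n < c" by (simp add: fast_time_def divide_less_eq)
  have "1 * fast_time c (Suc n) < 2 ^ (2 * n + 1) * fast_time c (Suc n)"
    using pos by (intro mult_strict_right_mono one_less_power) auto
  then show "fast_time c (Suc n) < fast_time c n" by (simp only: fast_time_Suc[of c n] mult_1)
qed

text \<open>The ratio is exactly \<open>1 / (2 ^ (2 * n + 1) - 1)\<close>. It is the Chebyshev bound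
  for the value at the next time exceeding the scale of the increment, and has to be summable for
  Borel-Cantelli.\<close>

lemma fast_time_ratio:
  assumes "0 < c"
  shows "fast_time c (Suc n) / (fast_time c n - fast_time c (Suc n)) \<le> (1 / 2) ^ n"
proof -
  let ?t = "fast_time c (Suc n)"
  have t: "0 < ?t" using assms by (rule fast_time_bounds)
  have "(2::real) ^ n + 1 \<le> 2 ^ n * 2 ^ n + 2 ^ n * 2 ^ n"
  proof -
    have "(1::real) \<le> 2 ^ n" by simp
    then have "1 * (2::real) ^ n \<le> 2 ^ n * 2 ^ n" by (intro mult_right_mono) auto
    with \<open>1 \<le> 2 ^ n\<close> show ?thesis by linarith
  qed
  also have "\<dots> = (2::real) ^ (2 * n + 1)" by (simp add: power_even_eq power2_eq_square)
  finally have le: "(2::real) ^ n \<le> 2 ^ (2 * n + 1) - 1" by simp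
  have "?t / (fast_time c n - ?t) = ?t / ((2 ^ (2 * n + 1) - 1) * ?t)"
    by (simp only: fast_time_Suc[of c n] left_diff_distrib mult_1)
  also have "\<dots> = 1 / (2 ^ (2 * n + 1) - 1)" using t by simp
  also have "\<dots> \<le> 1 / 2 ^ n" using le by (intro frac_le) auto
  finally show ?thesis by (simp add: power_one_over)
qed

lemma fast_time_antimono:
  assumes "0 < c" "m \<le> n"
  shows "fast_time c n \<le> fast_time c m"
  by (rule lift_Suc_antimono_le[where f = "fast_time c", OF _ assms(2)])
     (rule less_imp_le[OF fast_time_bounds(3)[OF assms(1)]])

lemma fast_time_in_unit: "0 < c \<Longrightarrow> c \<le> 1 \<Longrightarrow> fast_time c n \<in> {0..1}"
  using fast_time_bounds(1,2)[of c n] by simp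

definition fast_increment :: "(real \<Rightarrow> 'w \<Rightarrow> real) \<Rightarrow> real \<Rightarrow> nat \<Rightarrow> 'w \<Rightarrow> real" where
  "fast_increment W c n \<omega> = W (fast_time c n) \<omega> - W (fast_time c (Suc n)) \<omega>"

text \<open>The standard deviation of \<open>fast_increment W c n\<close>.\<close>

definition fast_scale :: "real \<Rightarrow> nat \<Rightarrow> real" where
  "fast_scale c n = sqrt (fast_time c n - fast_time c (Suc n))"

lemma fast_scale_pos: "0 < c \<Longrightarrow> 0 < fast_scale c n"
  using fast_time_bounds(3)[of c n] by (simp add: fast_scale_def)

context prob_space
begin

text \<open>Independent increments are given along increasing times, while the fast times decrease.
  A finite index set is therefore reversed through \<open>N - Suc n\<close>, which is its own
  inverse there.\<close>

lemma fast_increments_prob: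
  assumes bm: "std_brownian_motion M W" and c: "0 < c" "c \<le> 1"
    and J: "finite J" "J \<noteq> {}" and A: "\<And>n. A n \<in> sets borel"
  shows "prob (\<Inter>n\<in>J. fast_increment W c n -` A n \<inter> space M) =
    (\<Prod>n\<in>J. prob (fast_increment W c n -` A n \<inter> space M))"
proof -
  obtain N where N: "J \<subseteq> {..<N}" using J(1) finite_nat_iff_bounded by blast
  \<comment> \<open>Truncated subtraction makes this sequence constant from \<open>N\<close> on,
    hence monotone on all naturals.\<close>
  let ?t = "\<lambda>k. fast_time c (N - k)"
  let ?Y = "\<lambda>k \<omega>. W (?t (Suc k)) \<omega> - W (?t k) \<omega>"
  let ?r = "\<lambda>n. N - Suc n"
  have "mono ?t" by (intro monoI fast_time_antimono c) auto
  moreover have "range ?t \<subseteq> {0..1}"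
    by (intro image_subsetI fast_time_in_unit c)
  ultimately have ind: "indep_vars (\<lambda>_. borel) ?Y {..<N}"
    using bm unfolding std_brownian_motion_def by blast
  have r: "?r (?r n) = n" and Y: "?Y (?r n) = fast_increment W c n" if "n \<in> J" for n
  proof -
    have "N - Suc (N - Suc n) = n" "N - (N - Suc n) = Suc n" using that N by auto
    then show "?r (?r n) = n" "?Y (?r n) = fast_increment W c n"
      by (simp_all only: fast_increment_def[abs_def])
  qed
  have inj: "inj_on ?r J" by (rule inj_on_inverseI[of _ ?r]) (rule r)
  have "prob (\<Inter>k\<in>?r ` J. ?Y k -` A (?r k) \<inter> space M) = (\<Prod>k\<in>?r ` J. prob (?Y k -` A (?r k) \<inter> space M))"
    using J N A by (intro indep_varsD[OF ind]) auto
  also have "(\<Prod>k\<in>?r ` J. prob (?Y k -` A (?r k) \<inter> space M)) =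
      (\<Prod>n\<in>J. prob (fast_increment W c n -` A n \<inter> space M))"
    unfolding prod.reindex[OF inj] comp_def by (intro prod.cong refl, simp only: Y, simp only: r)
  also have "(\<Inter>k\<in>?r ` J. ?Y k -` A (?r k) \<inter> space M) = (\<Inter>n\<in>J. fast_increment W c n -` A n \<inter> space M)"
    unfolding image_image by (intro INF_cong refl, simp only: Y, simp only: r)
  finally show ?thesis .
qed

lemma fast_increment_distributed:
  assumes bm: "std_brownian_motion M W" and c: "0 < c" "c \<le> 1"
  shows "distributed M lborel (fast_increment W c n) (normal_density 0 (fast_scale c n))"
  unfolding fast_increment_def[abs_def] fast_scale_def
  using fast_time_bounds[OF c(1), of n] fast_time_bounds(1)[OF c(1), of "Suc n"] c
  by (intro std_brownian_motion_increment[OF bm]) auto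

lemma fast_value_small:
  assumes bm: "std_brownian_motion M W" and c: "0 < c" "c \<le> 1"
  shows "AE \<omega> in M. \<forall>\<^sub>F n in sequentially. \<bar>W (fast_time c (Suc n)) \<omega>\<bar> < fast_scale c n"
proof -
  \<comment> \<open>Only increments have a prescribed law, and \<open>W 0\<close> vanishes merely
    almost surely.\<close>
  let ?V = "\<lambda>n \<omega>. W (fast_time c (Suc n)) \<omega> - W 0 \<omega>"
  define A where "A = (\<lambda>n. {\<omega>\<in>space M. fast_scale c n \<le> \<bar>?V n \<omega>\<bar>})"
  note in01 = fast_time_in_unit[OF c]
  have Wm: "W t \<in> borel_measurable M" if "t \<in> {0..1}" for t
    using bm that by (simp add: std_brownian_motion_def)
  have Vm[measurable]: "?V n \<in> borel_measurable M" for n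
    using in01 by (intro borel_measurable_diff Wm) auto
  have Am[measurable]: "A n \<in> sets M" for n unfolding A_def by measurable
  have prob: "prob (A n) \<le> (1 / 2) ^ n" for n
  proof -
    let ?s = "sqrt (fast_time c (Suc n))"
    have s: "0 < ?s" using fast_time_bounds(1)[OF c(1)] by simp
    have D: "distributed M lborel (?V n) (normal_density 0 ?s)"
      using std_brownian_motion_increment[OF bm, of 0 "fast_time c (Suc n)"] in01[of "Suc n"]
        fast_time_bounds(1)[OF c(1), of "Suc n"] by simp
    have E: "expectation (?V n) = 0" by (rule normal_distributed_expectation[OF s D])
    have V: "variance (?V n) = ?s\<^sup>2" by (rule normal_distributed_variance[OF s D])
    have "integrable lborel (\<lambda>x. normal_density 0 ?s x * x\<^sup>2)"
      using integrable_normal_moment[OF s, of 0 2] by simp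
    then have I: "integrable M (\<lambda>\<omega>. (?V n \<omega>)\<^sup>2)"
      using distributed_integrable[OF D, of "\<lambda>x. x\<^sup>2"] by simp
    have "prob (A n) \<le> ?s\<^sup>2 / (fast_scale c n)\<^sup>2"
      using Chebyshev_inequality[OF Vm I fast_scale_pos[OF c(1)], of n] unfolding V unfolding E A_def by simp
    also have "\<dots> = fast_time c (Suc n) / (fast_time c n - fast_time c (Suc n))"
      using fast_time_bounds[OF c(1)] by (simp add: fast_scale_def less_imp_le)
    also have "\<dots> \<le> (1 / 2) ^ n" by (rule fast_time_ratio[OF c(1)])
    finally show ?thesis .
  qed
  have "summable (\<lambda>n. prob (A n))"
    by (rule summable_comparison_test'[of "\<lambda>n. (1 / 2 :: real) ^ n" 0]) (auto simp: prob summable_geometric)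
  then have "AE \<omega> in M. \<forall>\<^sub>F n in sequentially. \<omega> \<in> space M - A n"
    by (intro borel_cantelli_AE1) (auto simp: emeasure_eq_measure)
  moreover have "AE \<omega> in M. W 0 \<omega> = 0" using bm by (simp add: std_brownian_motion_def)
  ultimately show ?thesis
    by eventually_elim (auto simp: A_def not_le elim!: eventually_mono)
qed

text \<open>Independence is used twice: along the times within one component, giving the exponent
  \<open>card J\<close>, and across components, giving \<open>CARD('d)\<close>.\<close>

lemma fast_orthant_prob:
  fixes B :: "real \<Rightarrow> 'a \<Rightarrow> real ^ 'd" and s :: "'d \<Rightarrow> real"
  assumes bm: "std_brownian_motion_vec M B" and c: "0 < c" "c \<le> 1"
    and s: "\<And>i. \<bar>s i\<bar> = 1" and J: "finite J" "J \<noteq> {}"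
  shows "prob {\<omega>\<in>space M. \<forall>n\<in>J. \<forall>i. fast_scale c n < s i * fast_increment (\<lambda>t \<omega>. B t \<omega> $ i) c n \<omega>} =
    (measure (density lborel std_normal_density) {1<..} ^ CARD('d)) ^ card J"
proof -
  let ?q = "measure (density lborel std_normal_density) {1<..}"
  let ?W = "\<lambda>i t \<omega>. B t \<omega> $ i"
  have bmi: "std_brownian_motion M (?W i)" for i using bm by (simp add: std_brownian_motion_vec_def)
  note in01 = fast_time_in_unit[OF c]
  have single: "prob {\<omega>\<in>space M. \<forall>n\<in>J. fast_scale c n < s i * fast_increment (?W i) c n \<omega>} = ?q ^ card J" for i
  proof -
    have "{\<omega>\<in>space M. \<forall>n\<in>J. fast_scale c n < s i * fast_increment (?W i) c n \<omega>} =
        (\<Inter>n\<in>J. fast_increment (?W i) c n -` {x. fast_scale c n < s i * x} \<inter> space M)"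
      using J(2) by auto
    also have "prob \<dots> = (\<Prod>n\<in>J. prob (fast_increment (?W i) c n -` {x. fast_scale c n < s i * x} \<inter> space M))"
      by (rule fast_increments_prob[OF bmi c J]) measurable
    also have "\<dots> = (\<Prod>n\<in>J. ?q)"
    proof (rule prod.cong[OF refl])
      fix n
      have "fast_increment (?W i) c n -` {x. fast_scale c n < s i * x} \<inter> space M =
          {\<omega>\<in>space M. fast_scale c n < s i * fast_increment (?W i) c n \<omega>}" by auto
      then show "prob (fast_increment (?W i) c n -` {x. fast_scale c n < s i * x} \<inter> space M) = ?q"
        using normal_tail_prob[OF fast_increment_distributed[OF bmi c] fast_scale_pos[OF c(1)] s] by simp
    qed
    finally show ?thesis by simp
  qed
  let ?P = "\<Pi>\<^sub>M t\<in>{0..1::real}. (borel :: real measure)"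
  \<comment> \<open>A cylinder event depending on finitely many times, hence measurable in the
    product space in which the components are independent.\<close>
  define A where "A = (\<lambda>i. {x\<in>space ?P. \<forall>n\<in>J. fast_scale c n < s i * (x (fast_time c n) - x (fast_time c (Suc n)))})"
  have Am: "A i \<in> sets ?P" for i
  proof -
    have [measurable]: "(\<lambda>x. x (fast_time c n)) \<in> borel_measurable ?P" for n
      using in01 by (rule measurable_component_singleton)
    show ?thesis unfolding A_def using J(1) by measurable
  qed
  let ?X = "\<lambda>i \<omega>. \<lambda>t\<in>{0..1}. B t \<omega> $ i"
  have X: "?X i -` A i \<inter> space M = {\<omega>\<in>space M. \<forall>n\<in>J. fast_scale c n < s i * fast_increment (?W i) c n \<omega>}" for i
    using in01 by (auto simp: A_def fast_increment_def space_PiM restrict_def)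
  have "indep_vars (\<lambda>_. ?P) ?X UNIV" using bm by (simp add: std_brownian_motion_vec_def)
  then have "prob (\<Inter>i. ?X i -` A i \<inter> space M) = (\<Prod>i\<in>UNIV. prob (?X i -` A i \<inter> space M))"
    using Am by (intro indep_varsD_finite) auto
  also have "\<dots> = (?q ^ card J) ^ CARD('d)" unfolding X single by simp
  also have "(\<Inter>i. ?X i -` A i \<inter> space M) =
      {\<omega>\<in>space M. \<forall>n\<in>J. \<forall>i. fast_scale c n < s i * fast_increment (?W i) c n \<omega>}"
    unfolding X by auto
  finally show ?thesis by (simp flip: power_mult add: mult.commute)
qed

text \<open>Infinitely often all signed increments exceed their scale, and eventually the values at
  the later end are below it. At a common index the increment decides the sign of every
  coordinate.\<close>

lemma AE_visits_orthant:
  fixes B :: "real \<Rightarrow> 'a \<Rightarrow> real ^ 'd" and s :: "'d \<Rightarrow> real"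
  assumes bm: "std_brownian_motion_vec M B" and c: "0 < c" "c \<le> 1" and s: "\<And>i. \<bar>s i\<bar> = 1"
  shows "AE \<omega> in M. \<exists>t\<in>{0<..<c}. \<forall>i. 0 < s i * B t \<omega> $ i"
proof -
  let ?W = "\<lambda>i t \<omega>. B t \<omega> $ i"
  let ?p = "measure (density lborel std_normal_density) {1<..} ^ CARD('d)"
  define P where "P = (\<lambda>n \<omega>. \<forall>i. fast_scale c n < s i * fast_increment (?W i) c n \<omega>)"
  have bmi: "std_brownian_motion M (?W i)" for i using bm by (simp add: std_brownian_motion_vec_def)
  have [measurable]: "fast_increment (?W i) c n \<in> borel_measurable M" for i n
    using distributed_measurable[OF fast_increment_distributed[OF bmi c]] by simp
  have Pm[measurable]: "{\<omega>\<in>space M. P n \<omega>} \<in> sets M" for n unfolding P_def by measurable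
  have prob: "prob {\<omega>\<in>space M. \<forall>n\<in>J. P n \<omega>} = ?p ^ card J" if "finite J" "J \<noteq> {}" for J
    unfolding P_def by (rule fast_orthant_prob[OF bm c s that])
  have prob1: "prob {\<omega>\<in>space M. P n \<omega>} = ?p" for n using prob[of "{n}"] by simp
  have "indep_events (\<lambda>n. {\<omega>\<in>space M. P n \<omega>}) UNIV"
    unfolding indep_events_def
  proof (intro conjI allI impI)
    fix J :: "nat set" assume J: "J \<noteq> {}" "finite J"
    then have "(\<Inter>n\<in>J. {\<omega>\<in>space M. P n \<omega>}) = {\<omega>\<in>space M. \<forall>n\<in>J. P n \<omega>}" by auto
    then show "prob (\<Inter>n\<in>J. {\<omega>\<in>space M. P n \<omega>}) = (\<Prod>n\<in>J. prob {\<omega>\<in>space M. P n \<omega>})"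
      using prob[OF J(2,1)] by (simp add: prob1)
  qed auto
  from borel_0_1_law_AE[OF this] have inf: "AE \<omega> in M. infinite {n. P n \<omega>}"
  proof
    \<comment> \<open>The alternative in the zero-one law is impossible: the indicators would tend
      to \<open>0\<close>, and with them the probabilities, which all equal the positive constant
      \<open>?p\<close>.\<close>
    assume fin: "AE \<omega> in M. finite {n. P n \<omega>}"
    have "(\<lambda>n. \<integral>\<omega>. indicator {\<omega>\<in>space M. P n \<omega>} \<omega> \<partial>M) \<longlonglongrightarrow> (\<integral>\<omega>. 0 \<partial>M :: real)"
    proof (rule integral_dominated_convergence[where w = "\<lambda>_. 1"])
      show "AE \<omega> in M. (\<lambda>n. indicator {\<omega>\<in>space M. P n \<omega>} \<omega>) \<longlonglongrightarrow> (0::real)"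
        using fin
      proof eventually_elim
        case (elim \<omega>)
        then have "\<forall>\<^sub>F n in sequentially. \<not> P n \<omega>"
          by (simp add: eventually_cofinite flip: cofinite_eq_sequentially)
        then show ?case
          by (intro tendsto_eventually) (auto elim!: eventually_mono)
      qed
    qed (auto simp: indicator_def)
    then have "(\<lambda>n. ?p) \<longlonglongrightarrow> 0" using prob1 by simp
    then have "?p = 0" by (simp add: LIMSEQ_const_iff)
    then show ?thesis using std_normal_tail_pos by simp
  qed
  have "AE \<omega> in M. \<forall>i. \<forall>\<^sub>F n in sequentially. \<bar>?W i (fast_time c (Suc n)) \<omega>\<bar> < fast_scale c n"
    by (intro eventually_all_finite fast_value_small bmi c)
  with inf show ?thesis
  proof eventually_elim
    case (elim \<omega>)
    have "\<exists>\<^sub>F n in sequentially. P n \<omega>"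
      using elim(1) by (simp add: frequently_cofinite flip: cofinite_eq_sequentially)
    moreover have "\<forall>\<^sub>F n in sequentially. \<forall>i. \<bar>?W i (fast_time c (Suc n)) \<omega>\<bar> < fast_scale c n"
      using elim(2) by (intro eventually_all_finite) blast
    ultimately have "\<exists>\<^sub>F n in sequentially. P n \<omega> \<and> (\<forall>i. \<bar>?W i (fast_time c (Suc n)) \<omega>\<bar> < fast_scale c n)"
      by (rule frequently_eventually_frequently)
    then obtain n where n: "P n \<omega>" "\<And>i. \<bar>?W i (fast_time c (Suc n)) \<omega>\<bar> < fast_scale c n"
      by (blast dest: frequently_ex)
    have "0 < s i * B (fast_time c n) \<omega> $ i" for i
    proof -
      have "fast_scale c n < s i * (?W i (fast_time c n) \<omega> - ?W i (fast_time c (Suc n)) \<omega>)"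
        using n(1) by (simp add: P_def fast_increment_def)
      moreover have "\<bar>s i * ?W i (fast_time c (Suc n)) \<omega>\<bar> < fast_scale c n"
        using n(2)[of i] s[of i] by (simp add: abs_mult)
      ultimately show ?thesis by (simp add: right_diff_distrib)
    qed
    then show ?case
      using fast_time_bounds[OF c(1)] by (intro bexI[of _ "fast_time c n"]) auto
  qed
qed

text \<open>There are uncountably many \<open>y\<close> but finitely many orthants, so one null set
  serves all \<open>y\<close>. In the orthant opposite to the signs of \<open>y\<close>, every
  nonzero coordinate of \<open>y\<close> contributes a negative term to the inner product.\<close>

lemma AE_every_halfspace:
  fixes B :: "real \<Rightarrow> 'a \<Rightarrow> real ^ 'd"
  assumes bm: "std_brownian_motion_vec M B" and c: "0 < c" "c \<le> 1"
  shows "AE \<omega> in M. \<forall>y. y \<noteq> 0 \<longrightarrow> (\<exists>t\<in>{0<..<c}. y \<bullet> B t \<omega> < 0)"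
proof -
  let ?s = "\<lambda>(T :: 'd set) i. if i \<in> T then 1 else - 1 :: real"
  have "AE \<omega> in M. \<forall>T. \<exists>t\<in>{0<..<c}. \<forall>i. 0 < ?s T i * B t \<omega> $ i"
    by (intro eventually_all_finite AE_visits_orthant[OF bm c]) auto
  then show ?thesis
  proof eventually_elim
    case (elim \<omega>)
    show ?case
    proof (intro allI impI)
      fix y :: "real ^ 'd" assume "y \<noteq> 0"
      then obtain j where j: "y $ j \<noteq> 0" by (auto simp: vec_eq_iff)
      obtain t where t: "t \<in> {0<..<c}" "\<And>i. 0 < ?s {i. y $ i < 0} i * B t \<omega> $ i"
        using elim by blast
      have neg: "y $ i * B t \<omega> $ i < 0" if "y $ i \<noteq> 0" for i
        using t(2)[of i] that by (auto simp: mult_less_0_iff split: if_splits)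
      have "(\<Sum>i\<in>UNIV. y $ i * B t \<omega> $ i) < (\<Sum>i\<in>(UNIV :: 'd set). 0)"
        using neg by (intro sum_strict_mono_ex1) (auto intro: less_imp_le simp: le_less intro!: bexI[of _ j] j)
      then show "\<exists>t\<in>{0<..<c}. y \<bullet> B t \<omega> < 0"
        using t(1) by (auto simp: inner_vec_def)
    qed
  qed
qed

end

section \<open>Measurable selection\<close>

text \<open>Turns positivity at uncountably many times into countably many conditions. The uniform
  margin is essential: positivity at rational times alone would still allow a zero at an irrational
  one.\<close>

lemma continuous_pos_iff_rational:
  fixes h :: "real \<Rightarrow> real"
  assumes c: "continuous_on {0..1} h"
  shows "(\<forall>t\<in>{0..1}. 0 < h t) \<longleftrightarrow> (\<exists>n. \<forall>t\<in>{0..1} \<inter> \<rat>. inverse (real (Suc n)) \<le> h t)"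
proof
  assume pos: "\<forall>t\<in>{0..1}. 0 < h t"
  obtain s where s: "s \<in> {0..1}" "\<forall>t\<in>{0..1}. h s \<le> h t"
    using continuous_attains_inf[OF _ _ c] by auto
  obtain n where "inverse (real (Suc n)) < h s" using pos s(1) reals_Archimedean by blast
  then show "\<exists>n. \<forall>t\<in>{0..1} \<inter> \<rat>. inverse (real (Suc n)) \<le> h t"
    using s(2) by (intro exI[of _ n] ballI) force
next
  assume "\<exists>n. \<forall>t\<in>{0..1} \<inter> \<rat>. inverse (real (Suc n)) \<le> h t"
  then obtain n where n: "\<And>t. t \<in> {0..1} \<Longrightarrow> t \<in> \<rat> \<Longrightarrow> inverse (real (Suc n)) \<le> h t" by blast
  show "\<forall>t\<in>{0..1}. 0 < h t"
  proof (rule ballI, rule ccontr)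
    fix t :: real assume t: "t \<in> {0..1}" and "\<not> 0 < h t"
    moreover have "0 < inverse (real (Suc n))" by simp
    ultimately have e: "0 < inverse (real (Suc n)) - h t" by linarith
    then obtain d where d: "0 < d" "\<And>s. s \<in> {0..1} \<Longrightarrow> dist s t < d \<Longrightarrow> dist (h s) (h t) < inverse (real (Suc n)) - h t"
      using c t unfolding continuous_on_iff by metis
    have "max 0 (t - d) < min 1 (t + d)" using t d(1) by auto
    from Rats_dense_in_real[OF this] obtain s where s: "s \<in> \<rat>" "max 0 (t - d) < s" "s < min 1 (t + d)"
      by blast
    then have s01: "s \<in> {0..1}" and "dist s t < d" by (auto simp: dist_real_def abs_less_iff)
    then have "dist (h s) (h t) < inverse (real (Suc n)) - h t" by (rule d(2))
    then show False using n[OF s01 s(1)] by (simp add: dist_real_def)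
  qed
qed

lemma greedy_measurable:
  fixes q :: "nat \<Rightarrow> 'v::{second_countable_topology, t2_space, zero}"
  assumes [measurable]: "\<And>n. Measurable.pred M (P n)" "\<And>n. h n \<in> borel_measurable M"
  shows "(\<lambda>\<omega>. fst (greedy (\<lambda>n. P n \<omega>) (\<lambda>n. h n \<omega>) q n)) \<in> borel_measurable M"
    and "(\<lambda>\<omega>. snd (greedy (\<lambda>n. P n \<omega>) (\<lambda>n. h n \<omega>) q n)) \<in> borel_measurable M"
proof (induction n)
  case (Suc n)
  note [measurable] = Suc.IH
  show "(\<lambda>\<omega>. fst (greedy (\<lambda>n. P n \<omega>) (\<lambda>n. h n \<omega>) q (Suc n))) \<in> borel_measurable M"
    "(\<lambda>\<omega>. snd (greedy (\<lambda>n. P n \<omega>) (\<lambda>n. h n \<omega>) q (Suc n))) \<in> borel_measurable M"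
    unfolding greedy.simps if_distrib[of fst] if_distrib[of snd] fst_conv snd_conv by measurable
qed auto

text \<open>Every greedy iterate is obtained from countably many measurable events and functions, so
  it is measurable in \<open>\<omega>\<close>; off \<open>N\<close> the iterates converge to the
  minimizer.\<close>

lemma measurable_minimizer:
  fixes F :: "'w \<Rightarrow> real \<Rightarrow> 'v::euclidean_space"
  assumes meas: "\<And>t. t \<in> {0..1} \<Longrightarrow> (\<lambda>\<omega>. F \<omega> t) \<in> borel_measurable M"
    and N: "N \<in> sets M" and good: "\<And>\<omega>. \<omega> \<in> space M - N \<Longrightarrow> spanning_path (F \<omega>)"
  shows "\<exists>Y\<in>borel_measurable M. \<forall>\<omega>\<in>space M - N. spanning_path.minimizer (F \<omega>) (Y \<omega>)"
proof -
  define F' where "F' = (\<lambda>\<omega> t. if \<omega> \<in> N then 0 else F \<omega> t)"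
  have F': "F' \<omega> = F \<omega>" if "\<omega> \<in> space M - N" for \<omega> using that by (auto simp: F'_def)
  have meas': "(\<lambda>\<omega>. F' \<omega> t) \<in> borel_measurable M" if "t \<in> {0..1}" for t
    unfolding F'_def using N by (intro measurable_If_set meas that) auto
  obtain D :: "'v set" where D: "countable D" "\<And>X. open X \<Longrightarrow> X \<noteq> {} \<Longrightarrow> \<exists>d\<in>D. d \<in> X"
    using countable_dense_setE by blast
  have "D \<noteq> {}" using D(2)[of UNIV] by auto
  define q where "q = from_nat_into D"
  have dense: "\<exists>n. q n \<in> X" if "open X" "X \<noteq> {}" for X
    using D(2)[OF that] from_nat_into_surj[OF D(1)] unfolding q_def by metis
  define P where "P = (\<lambda>n \<omega>. \<exists>k. \<forall>t\<in>{0..1} \<inter> \<rat>. inverse (real (Suc k)) \<le> 1 + q n \<bullet> F' \<omega> t)"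
  \<comment> \<open>The value \<open>g_real (q n)\<close> as a limit of finite sums over fixed
    times, each measurable in \<open>\<omega>\<close>. The function is measurable everywhere and is
    identified with the value only for feasible \<open>q n\<close>.\<close>
  define h where "h = (\<lambda>n \<omega>. lim (\<lambda>m. (\<Sum>k<m. - 1 * ln (1 + q n \<bullet> F' \<omega> (real k / real m))) / real m))"
  have inner_meas: "(\<lambda>\<omega>. 1 + q n \<bullet> F' \<omega> t) \<in> borel_measurable M" if "t \<in> {0..1}" for n t
    by (intro borel_measurable_add borel_measurable_inner borel_measurable_const meas' that)
  have Pm: "Measurable.pred M (P n)" for n
  proof -
    have "(0::real) \<in> {0..1} \<inter> \<rat>" by simp
    then have "{\<omega>\<in>space M. P n \<omega>} =
        (\<Union>k. \<Inter>t\<in>{0..1} \<inter> \<rat>. {\<omega>\<in>space M. inverse (real (Suc k)) \<le> 1 + q n \<bullet> F' \<omega> t})"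
      unfolding P_def by blast
    also have "\<dots> \<in> sets M"
    proof (intro sets.countable_UN image_subsetI sets.countable_INT')
      show "countable ({0..1} \<inter> \<rat> :: real set)" using countable_rat by blast
      show "{0..1} \<inter> \<rat> \<noteq> ({} :: real set)" by force
      show "{\<omega>\<in>space M. inverse (real (Suc k)) \<le> 1 + q n \<bullet> F' \<omega> t} \<in> sets M"
        if "t \<in> {0..1} \<inter> \<rat>" for k and t :: real
        using inner_meas[of t n] that by (intro borel_measurable_le) auto
    qed
    finally show ?thesis by (simp add: pred_def)
  qed
  have hm: "h n \<in> borel_measurable M" for n
    unfolding h_def
    by (intro borel_measurable_lim_metric borel_measurable_divide borel_measurable_sum borel_measurable_times
        borel_measurable_ln inner_meas borel_measurable_const) (auto simp: divide_le_eq)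
  define Y where "Y = (\<lambda>\<omega>. lim (\<lambda>n. fst (greedy (\<lambda>n. P n \<omega>) (\<lambda>n. h n \<omega>) q n)))"
  have "Y \<in> borel_measurable M"
    unfolding Y_def by (intro borel_measurable_lim_metric greedy_measurable Pm hm)
  moreover have "spanning_path.minimizer (F \<omega>) (Y \<omega>)" if \<omega>: "\<omega> \<in> space M - N" for \<omega>
  proof -
    interpret spanning_path "F \<omega>" by (rule good[OF \<omega>])
    obtain a where a: "minimizer a" using minimizer_exists by blast
    have P: "P n \<omega> \<longleftrightarrow> q n \<in> K_set (F \<omega>)" for n
      unfolding P_def K_set_iff F'[OF \<omega>] by (rule continuous_pos_iff_rational[OF cont_affine, symmetric])
    have h: "h n \<omega> = g_real (q n)" if "q n \<in> K_set (F \<omega>)" for n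
      unfolding h_def F'[OF \<omega>] g_real_def using that
      by (intro limI Riemann_sum_LIMSEQ continuous_intros cont) (auto simp: K_set_iff)
    have "Y \<omega> = a"
      unfolding Y_def by (intro limI greedy_LIMSEQ[OF a dense P h])
    with a show ?thesis by simp
  qed
  ultimately show ?thesis by blast
qed

lemma borel_measurable_vec_componentwise:
  fixes X :: "'w \<Rightarrow> real ^ 'd"
  assumes "\<And>i. (\<lambda>\<omega>. X \<omega> $ i) \<in> borel_measurable M"
  shows "X \<in> borel_measurable M"
  using assms by (subst borel_measurable_euclidean_space) (auto simp: Basis_vec_def inner_axis)

theorem theorem1:
  fixes M :: "'w measure"
    and B :: "real \<Rightarrow> 'w \<Rightarrow> real ^ 'd"
    and w :: "real \<Rightarrow> real"
    and c :: real
    and f :: "'w \<Rightarrow> real \<Rightarrow> real ^ 'd"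
  assumes "prob_space M"
    and "std_brownian_motion_vec M B"
    and "continuous_on {0..1} w"
    and "\<forall>t\<in>{0..1}. 0 \<le> w t"
    and "0 < c" and "c \<le> 1"
    and "\<forall>t\<in>{0<..<c}. 0 < w t"
    and f_def: "f = (\<lambda>\<omega> t. w t *\<^sub>R B t \<omega>)"
  shows "\<exists>Y \<in> borel_measurable M. AE \<omega> in M.
    \<comment> \<open>(i)\<close>
    (\<forall>a. is_arg_min (g_fun (f \<omega>)) (\<lambda>a. a \<in> Kbar_set (f \<omega>)) a \<longleftrightarrow> a = Y \<omega>) \<and>
    Kbar_set (f \<omega>) = closure (K_set (f \<omega>)) \<and>
    open (K_set (f \<omega>)) \<and> bounded (K_set (f \<omega>)) \<and> convex (K_set (f \<omega>)) \<and>
    (\<forall>a\<in>K_set (f \<omega>). \<bar>g_fun (f \<omega>) a\<bar> \<noteq> \<infinity>) \<and>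
    strictly_convex_on (K_set (f \<omega>)) (\<lambda>a. real_of_ereal (g_fun (f \<omega>) a)) \<and>
    infinitely_differentiable_on (\<lambda>a. real_of_ereal (g_fun (f \<omega>) a)) (K_set (f \<omega>)) \<and>
    \<comment> \<open>(ii)\<close>
    -\<infinity> < g_fun (f \<omega>) (Y \<omega>) \<and> g_fun (f \<omega>) (Y \<omega>) < 0 \<and>
    Y \<omega> \<bullet> (\<integral>t. f \<omega> t \<partial>unit_lborel) > 0 \<and>
    0 \<le> ereal_integral unit_lborel
          (\<lambda>t. ereal (Y \<omega> \<bullet> f \<omega> t) / ereal (1 + Y \<omega> \<bullet> f \<omega> t)) \<and>
    ereal_integral unit_lborel
          (\<lambda>t. ereal (Y \<omega> \<bullet> f \<omega> t) / ereal (1 + Y \<omega> \<bullet> f \<omega> t)) < \<infinity> \<and>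
    \<comment> \<open>(iii)\<close>
    (Y \<omega> \<in> K_set (f \<omega>) \<longrightarrow> (\<forall>a. stationary (f \<omega>) a \<longleftrightarrow> a = Y \<omega>)) \<and>
    ((\<exists>a. stationary (f \<omega>) a) \<longrightarrow> (\<forall>a. stationary (f \<omega>) a \<longleftrightarrow> a = Y \<omega>))"
proof -
  interpret prob_space M by fact
  note bm = assms(2) and wc = assms(3) and c = assms(5,6)
  have bmi: "std_brownian_motion M (\<lambda>t \<omega>. B t \<omega> $ i)" for i
    using bm by (simp add: std_brownian_motion_vec_def)
  \<comment> \<open>An arbitrary coordinate: one nonzero component of the mean suffices.\<close>
  define i0 :: 'd where "i0 = undefined"
  have "AE \<omega> in M. \<forall>i. continuous_on {0..1} (\<lambda>t. B t \<omega> $ i)"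
    using bmi by (intro eventually_all_finite) (simp add: std_brownian_motion_def)
  moreover have "AE \<omega> in M. \<forall>y. y \<noteq> 0 \<longrightarrow> (\<exists>t\<in>{0<..<c}. y \<bullet> B t \<omega> < 0)"
    by (rule AE_every_halfspace[OF bm c])
  moreover have "AE \<omega> in M. integral {0..1} (\<lambda>t. w t * B t \<omega> $ i0) \<noteq> 0"
    using assms by (intro AE_weighted_integral_ne_0[OF bmi, of w c]) auto
  ultimately have "AE \<omega> in M. spanning_path (f \<omega>) \<and> (\<integral>t. f \<omega> t \<partial>unit_lborel) \<noteq> 0"
  proof eventually_elim
    case (elim \<omega>)
    have "continuous_on {0..1} (\<lambda>t. \<chi> i. B t \<omega> $ i)"
      using elim(1) by (intro continuous_on_vec_lambda) blast
    then have cont: "continuous_on {0..1} (f \<omega>)"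
      unfolding f_def by (auto intro!: continuous_intros wc simp: vec_lambda_eta)
    interpret spanning_path "f \<omega>"
    proof
      show "continuous_on {0..1} (f \<omega>)" by (rule cont)
      fix y :: "real ^ 'd" assume "y \<noteq> 0"
      then obtain t where "t \<in> {0<..<c}" "y \<bullet> B t \<omega> < 0" using elim(2) by blast
      then show "\<exists>t\<in>{0..1}. y \<bullet> f \<omega> t < 0"
        using assms(6,7) by (intro bexI[of _ t]) (auto simp: f_def mult_less_0_iff)
    qed
    have eq: "axis i0 1 \<bullet> f \<omega> t = w t * B t \<omega> $ i0" for t
      by (simp add: f_def inner_axis')
    have "axis i0 1 \<bullet> (\<integral>t. f \<omega> t \<partial>unit_lborel) = integral {0..1} (\<lambda>t. axis i0 1 \<bullet> f \<omega> t)"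
      unfolding integral_inner_path[symmetric] by (intro integral_unit_lborel continuous_intros cont)
    then have "(\<integral>t. f \<omega> t \<partial>unit_lborel) \<noteq> 0" using elim(3) unfolding eq by auto
    then show ?case using spanning_path_axioms by blast
  qed
  \<comment> \<open>A single measurable exceptional set is fixed here, off which both the choice of
    \<open>Y\<close> and all pathwise claims are made.\<close>
  then obtain N where N: "N \<in> null_sets M"
    "\<And>\<omega>. \<omega> \<in> space M - N \<Longrightarrow> spanning_path (f \<omega>) \<and> (\<integral>t. f \<omega> t \<partial>unit_lborel) \<noteq> 0"
    by (elim AE_E) blast
  have "(\<lambda>\<omega>. f \<omega> t) \<in> borel_measurable M" if t: "t \<in> {0..1}" for t
    unfolding f_def
  proof (rule borel_measurable_vec_componentwise)
    fix i
    have "(\<lambda>\<omega>. B t \<omega> $ i) \<in> borel_measurable M"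
      using bmi[of i] t by (simp add: std_brownian_motion_def)
    then show "(\<lambda>\<omega>. (w t *\<^sub>R B t \<omega>) $ i) \<in> borel_measurable M" by simp
  qed
  then obtain Y where Y: "Y \<in> borel_measurable M"
    "\<And>\<omega>. \<omega> \<in> space M - N \<Longrightarrow> spanning_path.minimizer (f \<omega>) (Y \<omega>)"
    using measurable_minimizer[of f M N] N by blast
  have "AE \<omega> in M. \<omega> \<in> space M - N"
    using AE_not_in[OF N(1)] AE_space by eventually_elim simp
  from AE_mp[OF this AE_I2] show ?thesis
  proof (rule bexI[OF _ Y(1)], intro impI, goal_cases)
    case (1 \<omega>)
    then have elim: "\<omega> \<in> space M - N" by blast
    interpret spanning_path "f \<omega>" using N(2)[OF elim] by blast
    have nz: "(\<integral>t. f \<omega> t \<partial>unit_lborel) \<noteq> 0" using N(2)[OF elim] by blast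
    have m: "minimizer (Y \<omega>)" by (rule Y(2)[OF elim])
    have st: "\<forall>a. stationary (f \<omega>) a \<longleftrightarrow> a = Y \<omega>" if "stationary (f \<omega>) (Y \<omega>)"
      using that m stationary_imp_minimizer minimizer_unique by blast
    show ?case
    proof (intro conjI impI)
      show "\<forall>a. is_arg_min (g_fun (f \<omega>)) (\<lambda>a. a \<in> Kbar_set (f \<omega>)) a \<longleftrightarrow> a = Y \<omega>"
        using m minimizer_unique by (auto simp: is_arg_min_iff_minimizer)
      show "\<forall>a\<in>K_set (f \<omega>). \<bar>g_fun (f \<omega>) a\<bar> \<noteq> \<infinity>" by (simp add: g_fun_K)
      show "-\<infinity> < g_fun (f \<omega>) (Y \<omega>)"
        using g_fun_eq[OF minimizer_log_integrable[OF m]] by simp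
      show "\<forall>a. stationary (f \<omega>) a \<longleftrightarrow> a = Y \<omega>" if "Y \<omega> \<in> K_set (f \<omega>)"
        by (intro st minimizer_imp_stationary m that)
      show "\<forall>a. stationary (f \<omega>) a \<longleftrightarrow> a = Y \<omega>" if "\<exists>a. stationary (f \<omega>) a"
        using that stationary_imp_minimizer minimizer_unique[OF m] by (intro st) blast
    qed (intro Kbar_eq_closure_K open_K bounded_K convex_K g_strictly_convex g_infinitely_differentiable
        minimizer_value_less_0[OF m nz] minimizer_inner_mean_pos[OF m nz] minimizer_quotient_integral[OF m])+
  qed
qed

end
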